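(* Let $q$ be a prime power, $L\ge1$, and let $\mathcal{N}_1$ be a multicast network with source dimension $\omega\ge2$ that is vector linearly solvable over $\mathrm{GF}(q)^L$ but not scalar linearly solvable over $\mathrm{GF}(q^L)$. Set $n=q^L$ and construct the multicast network $\mathcal{N}$ of source dimension $\omega$ as follows: create a source node $s'$ and a node $s$, with $\omega$ parallel edges from $s'$ to $s$; add $\mathcal{N}_1$ as a subnetwork and create $\omega$ edges from $s$ to the original source node $s_1$ of $\mathcal{N}_1$; add an $(n+1,2)$-combination network $\mathcal{N}_2$ as another subnetwork and create $2$ edges from $s$ to its original source node $s_2$; for every original receiver $t$ of $\mathcal{N}_2$, create $\omega-2$ edges from $s$ to $t$. The receivers of $\mathcal{N}$ are exactly the original receivers of $\mathcal{N}_1$ and of $\mathcal{N}_2$. Then $\mathcal{N}$ has a vector linear solution over $\mathrm{GF}(q)^L$; $\mathcal{N}$ is not scalar linearly solvable over $\mathrm{GF}(q')$ for any prime power $q'\le q^L$; and $\mathcal{N}$ is not vector linearly solvable over $\mathrm{GF}(q')^{L'}$ for any prime power $q'$ and integer $L'\ge1$ with $q'^{L'}<q^L$.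
   Context: A multicast network is a finite directed acyclic multigraph with a unique source node $s$ and a set $T$ of receivers; every edge has unit capacity. $In(v)$, $Out(v)$ denote the incoming/outgoing edges of node $v$; $\omega=|Out(s)|$ is the source dimension, and every receiver has $\omega$ edge-disjoint paths from $s$. For a prime power $q$ and $L\ge1$, a vector linear code over $\mathrm{GF}(q)^L$ (of dimension $L$ over $\mathrm{GF}(q)$) assigns to each pair $(d,e)$ of edges an $L\times L$ matrix $\mathbf{K}_{d,e}$ over $\mathrm{GF}(q)$, zero unless $d\in In(v)$, $e\in Out(v)$ for some node $v$. Global encoding kernels are $\omega L\times L$ matrices $\mathbf{F}_e$ with $[\mathbf{F}_e]_{e\in Out(s)}$ the $\omega L\times\omega L$ identity and $\mathbf{F}_e=\sum_{d\in In(v)}\mathbf{F}_d\mathbf{K}_{d,e}$ for $e\in Out(v)$, $v\ne s$. The code is a vector linear solution if $[\mathbf{F}_e]_{e\in In(t)}$ has rank $\omega L$ for every receiver $t$; the network is then vector linearly solvable over $\mathrm{GF}(q)^L$. Scalar linear codes/solutions over $\mathrm{GF}(Q)$ are the case of dimension $1$ over $\mathrm{GF}(Q)$. The $(n+1,2)$-combination network consists of a source node, $n+1$ intermediate nodes each connected from the source by one edge, and, for every pair of distinct intermediate nodes, a receiver connected by one edge from each of the two; it has source dimension $2$. *)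

theory Defs
  imports "Jordan_Normal_Form.DL_Rank" "HOL-Library.Cardinality"
begin

record ('v, 'e) network =
  nodes :: "'v set"
  edges :: "'e set"
  etail :: "'e \<Rightarrow> 'v"
  ehead :: "'e \<Rightarrow> 'v"
  source :: 'v
  receivers :: "'v set"

definition in_edges :: "('v, 'e) network \<Rightarrow> 'v \<Rightarrow> 'e set" where
  "in_edges N v = {e \<in> edges N. ehead N e = v}"

definition out_edges :: "('v, 'e) network \<Rightarrow> 'v \<Rightarrow> 'e set" where
  "out_edges N v = {e \<in> edges N. etail N e = v}"

definition source_dim :: "('v, 'e) network \<Rightarrow> nat" where
  "source_dim N = card (out_edges N (source N))"

definition is_path :: "('v, 'e) network \<Rightarrow> 'e list \<Rightarrow> 'v \<Rightarrow> 'v \<Rightarrow> bool" where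
  "is_path N p u w \<longleftrightarrow> p \<noteq> [] \<and> set p \<subseteq> edges N \<and>
     etail N (hd p) = u \<and> ehead N (last p) = w \<and>
     (\<forall>i. Suc i < length p \<longrightarrow> ehead N (p ! i) = etail N (p ! Suc i))"

definition multicast_network :: "('v, 'e) network \<Rightarrow> bool" where
  "multicast_network N \<longleftrightarrow>
     finite (nodes N) \<and> finite (edges N) \<and>
     (\<forall>e\<in>edges N. etail N e \<in> nodes N \<and> ehead N e \<in> nodes N) \<and>
     acyclic {(etail N e, ehead N e) | e. e \<in> edges N} \<and>
     source N \<in> nodes N \<and> in_edges N (source N) = {} \<and>
     receivers N \<subseteq> nodes N \<and>
     (\<forall>t\<in>receivers N. \<exists>P. length P = source_dim N \<and>
        (\<forall>p\<in>set P. is_path N p (source N) t) \<and> distinct (concat P))"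

definition vec_lin_code :: "('v, 'e) network \<Rightarrow> nat \<Rightarrow> ('e \<Rightarrow> 'e \<Rightarrow> 'a::field mat) \<Rightarrow> bool" where
  "vec_lin_code N L K \<longleftrightarrow>
     (\<forall>d e. K d e \<in> carrier_mat L L) \<and>
     (\<forall>d e. \<not> (\<exists>v. d \<in> in_edges N v \<and> e \<in> out_edges N v) \<longrightarrow> K d e = 0\<^sub>m L L)"

text \<open>F are the global encoding kernels of K: \<omega>L\<times>L matrices, [F_e]_{e\<in>Out(s)} is the
  \<omega>L\<times>\<omega>L identity (for some ordering of Out(s)), and F_e = \<Sum>_{d\<in>In(v)} F_d K_{d,e} for
  e \<in> Out(v), v \<noteq> s.\<close>
definition global_kernels ::
    "('v, 'e) network \<Rightarrow> nat \<Rightarrow> ('e \<Rightarrow> 'e \<Rightarrow> 'a::field mat) \<Rightarrow> ('e \<Rightarrow> 'a mat) \<Rightarrow> bool" where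
  "global_kernels N L K F \<longleftrightarrow>
     (let w = source_dim N in
       (\<forall>e\<in>edges N. F e \<in> carrier_mat (w * L) L) \<and>
       (\<exists>idx. bij_betw idx (out_edges N (source N)) {..<w} \<and>
          (\<forall>e\<in>out_edges N (source N). \<forall>i<w * L. \<forall>j<L.
              F e $$ (i, j) = (if i = idx e * L + j then 1 else 0))) \<and>
       (\<forall>v\<in>nodes N - {source N}. \<forall>e\<in>out_edges N v.
          F e = mat (w * L) L (\<lambda>(i, j). \<Sum>d\<in>in_edges N v. (F d * K d e) $$ (i, j))))"

definition concat_kernels :: "nat \<Rightarrow> ('e \<Rightarrow> 'a mat) \<Rightarrow> 'e list \<Rightarrow> 'a mat" where
  "concat_kernels r F es = mat_of_cols r (concat (map (\<lambda>e. cols (F e)) es))"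

definition vec_lin_solution ::
    "('v, 'e) network \<Rightarrow> nat \<Rightarrow> ('e \<Rightarrow> 'e \<Rightarrow> 'a::field mat) \<Rightarrow> ('e \<Rightarrow> 'a mat) \<Rightarrow> bool" where
  "vec_lin_solution N L K F \<longleftrightarrow>
     vec_lin_code N L K \<and> global_kernels N L K F \<and>
     (\<forall>t\<in>receivers N. \<exists>es. distinct es \<and> set es = in_edges N t \<and>
        vec_space.rank (source_dim N * L) (concat_kernels (source_dim N * L) F es)
          = source_dim N * L)"

text \<open>vector linearly solvable over GF(q)^L, where GF(q) is the finite field type 'a;
  scalar linear solvability over GF(Q) is the case L = 1.\<close>
definition vec_lin_solvable :: "'a::field itself \<Rightarrow> ('v, 'e) network \<Rightarrow> nat \<Rightarrow> bool" where
  "vec_lin_solvable _ N L \<longleftrightarrow> (\<exists>(K :: 'e \<Rightarrow> 'e \<Rightarrow> 'a mat) F. vec_lin_solution N L K F)"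

datatype comb_node = CSrc | CMid nat | CRcv nat nat
datatype comb_edge = CEs nat | CEr nat nat

definition comb_network :: "nat \<Rightarrow> (comb_node, comb_edge) network" where
  "comb_network m = \<lparr>
     nodes = {CSrc} \<union> CMid ` {..<m} \<union> {CRcv i j | i j. i < j \<and> j < m},
     edges = CEs ` {..<m} \<union> {CEr i j | i j. i \<noteq> j \<and> i < m \<and> j < m},
     etail = (\<lambda>e. case e of CEs i \<Rightarrow> CSrc | CEr i j \<Rightarrow> CMid i),
     ehead = (\<lambda>e. case e of CEs i \<Rightarrow> CMid i | CEr i j \<Rightarrow> CRcv (min i j) (max i j)),
     source = CSrc,
     receivers = {CRcv i j | i j. i < j \<and> j < m} \<rparr>"

datatype ('v1, 'v2) cnode = NSrc' | NS | V1 'v1 | V2 'v2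
datatype ('e1, 'e2, 'v2) cedge = ETop nat | EToS1 nat | EToS2 nat | EToT 'v2 nat | F1 'e1 | F2 'e2

definition construct_network ::
    "('v1, 'e1) network \<Rightarrow> ('v2, 'e2) network \<Rightarrow> nat \<Rightarrow>
     (('v1, 'v2) cnode, ('e1, 'e2, 'v2) cedge) network" where
  "construct_network N1 N2 w = \<lparr>
     nodes = {NSrc', NS} \<union> V1 ` nodes N1 \<union> V2 ` nodes N2,
     edges = ETop ` {..<w} \<union> EToS1 ` {..<w} \<union> EToS2 ` {..<2}
             \<union> {EToT t i | t i. t \<in> receivers N2 \<and> i < w - 2}
             \<union> F1 ` edges N1 \<union> F2 ` edges N2,
     etail = (\<lambda>e. case e of ETop _ \<Rightarrow> NSrc' | EToS1 _ \<Rightarrow> NS | EToS2 _ \<Rightarrow> NS | EToT _ _ \<Rightarrow> NS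
                 | F1 d \<Rightarrow> V1 (etail N1 d) | F2 d \<Rightarrow> V2 (etail N2 d)),
     ehead = (\<lambda>e. case e of ETop _ \<Rightarrow> NS | EToS1 _ \<Rightarrow> V1 (source N1) | EToS2 _ \<Rightarrow> V2 (source N2)
                 | EToT t _ \<Rightarrow> V2 t | F1 d \<Rightarrow> V1 (ehead N1 d) | F2 d \<Rightarrow> V2 (ehead N2 d)),
     source = NSrc',
     receivers = V1 ` receivers N1 \<union> V2 ` receivers N2 \<rparr>"

end

theory Submission
  imports Defs "HOL-Algebra.Sylow" "Berlekamp_Zassenhaus.Berlekamp_Type_Based"
begin

text \<open>
  Transposing the kernels turns a code into a flow of messages: on a source message \<open>y\<close>, edge
  \<open>e\<close> carries the vector \<open>F_e\<^sup>T y\<close>, and a receiver decodes iff only \<open>y = 0\<close> makes all its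
  incoming messages vanish.

  A solution of the combination network with \<open>m\<close> middle nodes forces pairwise jointly injective
  maps \<open>h_i : V \<times> V \<rightarrow> V\<close> with \<open>V = GF(q')^L'\<close>; the fibres through a common point
  meet only there, so \<open>m (|V| - 1) \<le> |V|^2 - 1\<close>, i.e. \<open>m \<le> |V| + 1\<close>. Conversely
  the multiplication maps of \<open>GF(q^L)\<close>, written as matrices over \<open>GF(q)\<close>, attain
  \<open>q^L + 1\<close>. In the remaining scalar case the field has exactly \<open>q^L\<close> elements, and
  inverting the map from source messages to the messages leaving the source of \<open>N1\<close> turns a
  solution of the large network into one of \<open>N1\<close>.
\<close>

section \<open>Embeddings of finite fields\<close>

text \<open>Fields are types here, so two fields of equal size are isomorphic but never equal. The
  embedding lemma therefore serves twice: it makes GF(q^L) a vector space over GF(q), and it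
  identifies any field of size q^L with the one over which \<open>N1\<close> is assumed unsolvable.

  Joint injectivity of h_i and h_j is not immediate, because a receiver decodes from w messages of
  which w - 2 bypass the combination network. What decoding gives directly is surjectivity: with
  exactly w incoming edges, unique decoding is a bijection of V^w by counting, so the two messages
  arriving from the middle nodes take every pair of values. They are computed from only two
  messages, which yields a map of V x V onto itself, hence an injective one.

  The number q^L + 1 counts the points of the projective line over GF(q^L): lines through the origin
  partition the nonzero vectors of the plane, so the bound is attained. The combination network thus
  excludes every smaller alphabet, but cannot tell scalar from vector codes over the alphabet size
  q^L itself; \<open>N1\<close> is there to separate these two.\<close>

lemma finite_field_generator:
  obtains \<alpha> :: "'b::{field,finite}" where "\<And>x. x \<noteq> 0 \<Longrightarrow> \<exists>i::nat. x = \<alpha> ^ i"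
proof -
  let ?R = "class_ring :: 'b ring"
  have pow: "x [^]\<^bsub>?R\<^esub> (i::nat) = x ^ i" for x :: 'b and i
    by (induction i) (simp_all add: nat_pow_def class_ring_simps mult.commute)
  obtain a where "carrier (mult_of ?R) = {a [^]\<^bsub>?R\<^esub> i | i::nat. i \<in> UNIV}"
    using field.finite_field_mult_group_has_gen[OF class_field[where ?'a='b]]
    by (auto simp: class_ring_simps simp del: carrier_mult_of)
  then have "UNIV - {0} = {a ^ i | i::nat. True}"
    unfolding pow by (simp add: carrier_mult_of class_ring_simps)
  then show thesis using that[of a] by blast
qed

text \<open>The exponent is a power of the cardinality so that X^N - X, with N the size of the
  larger field, vanishes on the smaller field too.\<close>

lemma finite_field_pow_card_power:
  fixes x :: "'b::{field,finite}"
  shows "x ^ (CARD('b) ^ k) = x"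
proof -
  let ?R = "class_ring :: 'b ring"
  interpret U: group "mult_of ?R" by (rule field.field_mult_group[OF class_field])
  have pow: "x [^]\<^bsub>mult_of ?R\<^esub> (i::nat) = x ^ i" for x :: 'b and i
    by (induction i) (simp_all add: nat_pow_def class_ring_simps mult.commute)
  have one: "y ^ CARD('b) = y" for y :: 'b
  proof (cases "y = 0")
    case False
    have "y ^ (CARD('b) - 1) = 1"
      using U.pow_order_eq_1[of y] False
      by (simp add: pow Coset.order_def carrier_mult_of class_ring_simps)
    then show ?thesis
      by (metis power_minus_mult zero_less_card_finite mult_1)
  qed simp
  show ?thesis by (induction k) (simp_all add: power_mult one)
qed

text \<open>Sylow's theorem for the additive group, with exponent 1 whatever the full power of p in
  the order, is Cauchy's theorem: some x other than 0 satisfies p x = 0, and cancelling x gives p =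
  0 in the field.\<close>

lemma CHAR_eq_of_dvd_card:
  assumes p: "prime p" and dvd: "p dvd CARD('b::{field,finite})"
  shows "CHAR('b) = p"
proof -
  define G :: "'b monoid" where "G = \<lparr>carrier = UNIV, monoid.mult = (+), one = 0\<rparr>"
  have G: "group G"
    by (rule groupI) (auto simp: G_def add.assoc intro: exI[of _ "- _"] left_minus)
  interpret G: group G by (rule G)
  have pow: "x [^]\<^bsub>G\<^esub> (n::nat) = of_nat n * x" for x n
    by (induction n) (simp_all add: G_def nat_pow_def algebra_simps)
  have "Coset.order G = p ^ 1 * (CARD('b) div p)"
    using dvd by (simp add: Coset.order_def G_def)
  then obtain H where H: "subgroup H G" "card H = p ^ 1"
    using sylow_thm[OF p G, of 1 "CARD('b) div p"] by (auto simp: G_def)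
  have p1: "p > 1" using p prime_gt_1_nat by blast
  have "\<not> H \<subseteq> {0}"
    using card_mono[of "{0::'b}" H] H(2) p1 by auto
  then obtain x where x: "x \<in> H" "x \<noteq> 0" by blast
  interpret H: group "G\<lparr>carrier := H\<rparr>" by (rule G.subgroup_imp_group[OF H(1)])
  have "x [^]\<^bsub>G\<^esub> p = 0"
    using H.pow_order_eq_1[of x] x H(2)
    by (simp add: Coset.order_def G_def nat_pow_def)
  then have "of_nat p = (0::'b)" using x(2) by (simp add: pow)
  then have "CHAR('b) dvd p" by (simp add: of_nat_eq_0_iff_char_dvd)
  moreover have "CHAR('b) \<noteq> 1" by simp
  ultimately show ?thesis using p by (metis prime_nat_iff)
qed

lemma finite_field_card_CHAR_eq:
  assumes "CARD('b::{field,finite}) ^ k = CARD('c::{field,finite})"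
  shows "CHAR('b) = CHAR('c)"
proof -
  have p: "prime CHAR('c)"
    by (intro prime_CHAR_semidom finite_imp_CHAR_pos) simp
  have "CHAR('c) dvd CARD('b) ^ k" using assms CHAR_dvd_CARD[where ?'a='c] by simp
  with p have "CHAR('c) dvd CARD('b)" using prime_dvd_power by blast
  then show ?thesis using CHAR_eq_of_dvd_card p by blast
qed

text \<open>
  With \<open>\<alpha>\<close> a generator of the unit group of \<open>'b\<close> and \<open>f\<close> a monic integer
  polynomial of least degree vanishing at \<open>\<alpha>\<close>, the integer polynomials vanishing at \<open>\<alpha>\<close>
  form the ideal \<open>(p, f)\<close>. It contains \<open>X^N - X\<close>, which splits over \<open>'c\<close>, so \<open>f\<close>
  has a root \<open>r\<close> there, and \<open>g(\<alpha>) \<mapsto> g(r)\<close> is the embedding.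
\<close>

lemma finite_field_embedding:
  assumes card: "CARD('b::{field,finite}) ^ k = CARD('c::{field,finite})"
  obtains \<phi> :: "'b::{field,finite} \<Rightarrow> 'c::{field,finite}" where "field_hom \<phi>"
proof -
  define p where "p = CHAR('b)"
  have pc: "p = CHAR('c)" unfolding p_def using finite_field_card_CHAR_eq[OF card] .
  have p: "prime p" unfolding p_def
    by (intro prime_CHAR_semidom finite_imp_CHAR_pos) simp
  have p0b: "of_int (int p) = (0::'b)" by (simp add: p_def)
  have p0c: "of_int (int p) = (0::'c)" by (simp add: pc)
  define N where "N = CARD('c)"
  have N: "N > 1"
    unfolding N_def using card_mono[of "UNIV :: 'c set" "{0, 1}"] by auto
  obtain \<alpha> :: 'b where gen: "\<And>x. x \<noteq> 0 \<Longrightarrow> \<exists>i::nat. x = \<alpha> ^ i"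
    by (rule finite_field_generator) blast
  define E :: "int poly \<Rightarrow> 'b" where "E f = poly (of_int_poly f) \<alpha>" for f
  define X :: "int poly" where "X = monom 1 N - monom 1 1"
  have EX: "E X = 0"
    using finite_field_pow_card_power[of \<alpha> k]
    by (simp add: E_def X_def of_int_poly_hom.hom_minus poly_monom N_def card)
  have E_add: "E (f + g) = E f + E g" and E_mult: "E (f * g) = E f * E g"
    and E_diff: "E (f - g) = E f - E g" and E_smult: "E (smult a f) = of_int a * E f"
    and E_monom: "E (monom a i) = of_int a * \<alpha> ^ i" for f g a i
    by (simp_all add: E_def of_int_poly_hom.hom_add of_int_poly_hom.hom_mult
        of_int_poly_hom.hom_minus of_int_hom.map_poly_hom_smult poly_monom)
  define P where "P f \<longleftrightarrow> lead_coeff f = 1 \<and> E f = 0" for f :: "int poly"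
  have "P X"
  proof -
    have "degree X = N" unfolding X_def diff_conv_add_uminus using N
      by (subst degree_add_eq_left) (auto simp: degree_monom_eq)
    then have "lead_coeff X = 1" using N by (simp add: X_def)
    with EX show ?thesis by (simp add: P_def)
  qed
  then obtain f where f: "P f" and fmin: "\<And>g. P g \<Longrightarrow> degree f \<le> degree g"
    using ex_has_least_nat[of P X degree] by blast
  \<comment> \<open>A leading coefficient not divisible by \<open>p\<close> can be made \<open>1\<close> modulo \<open>p\<close>, so minimality applies.\<close>
  have div: "\<exists>u v. g = f * u + smult (int p) v" if "E g = 0" "\<And>i. i \<ge> n \<Longrightarrow> coeff g i = 0" for g n
    using that
  proof (induction n arbitrary: g)
    case 0
    then have "g = 0" by (intro poly_eqI) simp
    then show ?case by (intro exI[of _ 0]) simp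
  next
    case (Suc m)
    let ?c = "coeff g m"
    show ?case
    proof (cases "int p dvd ?c")
      case True
      then obtain c where c: "?c = int p * c" by blast
      have "E (g - smult (int p) (monom c m)) = 0"
        using Suc.prems(1) p0b by (simp add: E_diff E_smult)
      moreover have "coeff (g - smult (int p) (monom c m)) i = 0" if "i \<ge> m" for i
        using that Suc.prems(2)[of i] c by (cases "i = m") auto
      ultimately obtain u v where "g - smult (int p) (monom c m) = f * u + smult (int p) v"
        using Suc.IH by blast
      then have "g = f * u + smult (int p) (v + monom c m)"
        by (simp add: smult_add_right algebra_simps)
      then show ?thesis by blast
    next
      case False
      show ?thesis
      proof (cases "degree f \<le> m")
        case True
        let ?h = "monom ?c (m - degree f)"
        have "E (g - f * ?h) = 0"
          using Suc.prems(1) f by (simp add: E_diff E_mult P_def)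
        moreover have "coeff (g - f * ?h) i = 0" if "i \<ge> m" for i
        proof (cases "i = m")
          case True
          with \<open>degree f \<le> m\<close> f show ?thesis
            by (simp add: P_def mult.commute[of f] coeff_monom_mult)
        next
          case False
          with that have "i > m" by simp
          then have "i - (m - degree f) > degree f" using \<open>degree f \<le> m\<close> by linarith
          then show ?thesis using \<open>i > m\<close> Suc.prems(2)[of i]
            by (simp add: mult.commute[of f] coeff_monom_mult coeff_eq_0)
        qed
        ultimately obtain u v where "g - f * ?h = f * u + smult (int p) v"
          using Suc.IH by blast
        then have "g = f * (u + ?h) + smult (int p) v"
          by (simp add: algebra_simps)
        then show ?thesis by blast
      next
        case dlt: False
        have "algebraic_semidom_class.coprime ?c (int p)"
          using False p prime_imp_coprime[of "int p" ?c] by (simp add: algebraic_semidom_class.coprime_commute)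
        then obtain c where "[?c * c = 1] (mod int p)"
          using cong_solve_coprime_int by blast
        then obtain t where t: "?c * c - 1 = int p * t"
          by (metis cong_iff_dvd_diff dvdE)
        \<comment> \<open>Scaling by an inverse modulo p makes the leading coefficient 1 + p t;
          removing p t X^m makes it exactly 1 and keeps the value 0 at \<alpha>. A monic polynomial
          of degree m < \<open>degree f\<close> contradicts the choice of \<open>f\<close>.\<close>
        define h where "h = smult c g - smult (int p) (monom t m)"
        have hm: "coeff h m = 1" unfolding h_def using t by (simp add: algebra_simps)
        have hi: "coeff h i = 0" if "i > m" for i unfolding h_def using that Suc.prems(2) by simp
        have "degree h = m"
          using hm hi by (metis le_degree degree_le le_antisym zero_neq_one)
        moreover have "E h = 0"
          using Suc.prems(1) p0b by (simp add: h_def E_diff E_smult)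
        ultimately have "P h" by (simp add: P_def hm)
        with fmin dlt \<open>degree h = m\<close> show ?thesis by force
      qed
    qed
  qed
  have fnz: "f \<noteq> 0" using f by (auto simp: P_def)
  have dpos: "degree f > 0"
  proof (rule ccontr)
    assume "\<not> degree f > 0"
    then have "f = 1" using f by (metis P_def degree_0_id gr0I of_int_poly_hom.hom_one one_pCons)
    then show False using f by (simp add: P_def E_def)
  qed
  define E' :: "'c \<Rightarrow> int poly \<Rightarrow> 'c" where "E' r g = poly (of_int_poly g) r" for r g
  \<comment> \<open>Otherwise X^N - X = f' u' over \<open>'c\<close>, where the left side vanishes
    everywhere and f' nowhere, so u' would have N roots although its degree is N -
    \<open>degree f\<close> < N.\<close>
  have "\<exists>r. E' r f = 0"
  proof (rule ccontr)
    assume no: "\<nexists>r. E' r f = 0"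
    obtain u v where uv: "X = f * u + smult (int p) v"
      using div[OF EX, of "Suc (degree X)"] by (auto simp: coeff_eq_0)
    define f' u' :: "'c poly" where "f' = of_int_poly f" and "u' = of_int_poly u"
    have XX: "f' * u' = monom 1 N - monom 1 1"
    proof -
      have "of_int_poly X = f' * u' + smult (of_int (int p)) (of_int_poly v)"
        unfolding uv f'_def u'_def
        by (simp only: of_int_poly_hom.hom_add of_int_poly_hom.hom_mult of_int_hom.map_poly_hom_smult)
      then show ?thesis by (simp add: p0c X_def of_int_poly_hom.hom_minus del: of_int_of_nat_eq)
    qed
    have "poly u' r = 0" for r
    proof -
      have "poly f' r * poly u' r = 0"
        using finite_field_pow_card_power[of r 1]
        by (simp add: poly_mult[symmetric] XX poly_monom N_def)
      then show ?thesis using no by (auto simp: E'_def f'_def)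
    qed
    then have roots: "{r. poly u' r = 0} = UNIV" by auto
    have dX: "degree (f' * u') = N" unfolding XX diff_conv_add_uminus using N
      by (subst degree_add_eq_left) (auto simp: degree_monom_eq)
    then have nz: "f' \<noteq> 0" "u' \<noteq> 0" using N by auto
    have "degree f' = degree f" unfolding f'_def using f
      by (intro map_poly_degree_eq) (simp add: P_def)
    then have "degree u' < N" using dX dpos nz by (simp add: degree_mult_eq)
    moreover have "N \<le> degree u'"
      using poly_roots_degree[OF nz(2)] by (simp add: roots N_def)
    ultimately show False by simp
  qed
  then obtain r where r: "E' r f = 0" by blast
  have E'_add: "E' r (f + g) = E' r f + E' r g" and E'_mult: "E' r (f * g) = E' r f * E' r g"
    and E'_diff: "E' r (f - g) = E' r f - E' r g" and E'_smult: "E' r (smult a f) = of_int a * E' r f"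
    for f g a
    by (simp_all add: E'_def of_int_poly_hom.hom_add of_int_poly_hom.hom_mult
        of_int_poly_hom.hom_minus of_int_hom.map_poly_hom_smult)
  \<comment> \<open>Evaluation at r kills both generators p and f of the ideal. This makes \<phi>
    independent of the representative picked by \<open>SOME\<close>.\<close>
  have ker: "E' r g = 0" if z: "E g = 0" for g
  proof -
    obtain u v where "g = f * u + smult (int p) v"
      using div[OF z, of "Suc (degree g)"] by (auto simp: coeff_eq_0)
    then show ?thesis using r p0c by (simp add: E'_add E'_mult E'_smult del: of_int_of_nat_eq)
  qed
  \<comment> \<open>Here \<alpha> has to be a generator: every nonzero element is the value of a
    monomial.\<close>
  have surj: "\<exists>g. E g = x" for x
  proof (cases "x = 0")
    case True
    then show ?thesis by (intro exI[of _ 0]) (simp add: E_def)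
  next
    case False
    then obtain i where "x = \<alpha> ^ i" using gen by blast
    then show ?thesis by (intro exI[of _ "monom 1 i"]) (simp add: E_monom)
  qed
  define \<phi> where "\<phi> x = E' r (SOME g. E g = x)" for x
  have \<phi>: "\<phi> (E g) = E' r g" for g
  proof -
    have "E (SOME h. E h = E g) = E g" by (rule someI_ex) blast
    then have "E ((SOME h. E h = E g) - g) = 0" by (simp add: E_diff)
    then have "E' r ((SOME h. E h = E g) - g) = 0" by (rule ker)
    then show ?thesis by (simp add: \<phi>_def E'_diff)
  qed
  have "field_hom \<phi>"
  proof
    have "E 0 = 0" "E 1 = 1" "E' r 0 = 0" "E' r 1 = 1" by (simp_all add: E_def E'_def)
    then show "\<phi> 0 = 0" "\<phi> 1 = 1" using \<phi>[of 0] \<phi>[of 1] by simp_all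
    fix x y
    obtain g h where "x = E g" "y = E h" using surj by metis
    then show "\<phi> (x + y) = \<phi> x + \<phi> y" "\<phi> (x * y) = \<phi> x * \<phi> y"
      using \<phi>[of "g + h"] \<phi>[of "g * h"]
      by (simp_all add: \<phi> E_add E_mult E'_add E'_mult)
  qed
  then show thesis by (rule that)
qed

section \<open>Matrices of a field extension\<close>

text \<open>\<open>A x\<close> is multiplication by x in coordinates over the subfield. If two such
  maps agree on v, then (x - y) times the element with coordinates v is 0, and a field has no zero
  divisors.\<close>

lemma field_extension_matrices:
  assumes card: "CARD('c::{field,finite}) = CARD('a::{field,finite}) ^ l"
  obtains A :: "'c::{field,finite} \<Rightarrow> 'a::{field,finite} mat"
  where "\<And>x. A x \<in> carrier_mat l l"
    and "\<And>x y v. x \<noteq> y \<Longrightarrow> v \<in> carrier_vec l \<Longrightarrow> A x *\<^sub>v v = A y *\<^sub>v v \<Longrightarrow> v = 0\<^sub>v l"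
proof -
  obtain \<phi> :: "'a \<Rightarrow> 'c" where "field_hom \<phi>"
    using finite_field_embedding[where ?'b='a and ?'c='c, OF card[symmetric]] .
  then interpret \<phi>: field_hom \<phi> .
  interpret V: vector_space "\<lambda>a x. \<phi> a * x"
    by (rule vector_space.intro)
      (simp_all only: distrib_left distrib_right mult.assoc mult_1 \<phi>.hom_add \<phi>.hom_mult \<phi>.hom_one)
  obtain B :: "'c set" where indep: "V.independent B" and span: "UNIV \<subseteq> V.span B"
    by (rule V.basis_exists[of UNIV]) simp
  have finB: "finite B" by simp
  define d where "d = card B"
  obtain b where b: "bij_betw b {..<d} B"
    using ex_bij_betw_nat_finite[OF finB] by (auto simp: d_def lessThan_atLeast0)
  define \<iota> :: "'a vec \<Rightarrow> 'c" where "\<iota> v = (\<Sum>j<d. \<phi> (v $ j) * b j)" for v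
  have inj0: "v = 0\<^sub>v d" if v: "v \<in> carrier_vec d" and z: "\<iota> v = 0" for v
  proof -
    define g where "g x = v $ (the_inv_into {..<d} b x)" for x
    have gb: "g (b j) = v $ j" if "j < d" for j
      using that b by (simp add: g_def bij_betw_def the_inv_into_f_f)
    have "(\<Sum>x\<in>B. \<phi> (g x) * x) = (\<Sum>j<d. \<phi> (g (b j)) * b j)"
      by (rule sum.reindex_bij_betw[OF b, symmetric])
    also have "\<dots> = 0" using z by (simp add: \<iota>_def gb)
    finally have "g x = 0" if "x \<in> B" for x
      using V.independentD[OF indep finB subset_refl _ that] by blast
    then have "v $ j = 0" if "j < d" for j
      using gb[OF that] that b by (metis bij_betwE lessThan_iff)
    then show ?thesis using v by (intro eq_vecI) auto
  qed
  have \<iota>_diff: "\<iota> (u - v) = \<iota> u - \<iota> v" if "u \<in> carrier_vec d" "v \<in> carrier_vec d" for u v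
    using that by (simp add: \<iota>_def \<phi>.hom_minus left_diff_distrib sum_subtractf)
  have inj: "inj_on \<iota> (carrier_vec d)"
  proof (rule inj_onI)
    fix u v assume uv: "u \<in> carrier_vec d" "v \<in> carrier_vec d" "\<iota> u = \<iota> v"
    then have "u - v = 0\<^sub>v d" by (intro inj0) (simp_all add: \<iota>_diff)
    then have "u $ j = v $ j" if "j < d" for j
      using that uv index_minus_vec(1)[of j v u] by simp
    then show "u = v" using uv by (intro eq_vecI) auto
  qed
  have surj: "\<exists>v\<in>carrier_vec d. \<iota> v = x" for x
  proof -
    have "x \<in> V.span B" using span by blast
    then obtain g where "x = (\<Sum>c\<in>B. \<phi> (g c) * c)" using V.span_finite[OF finB] by auto
    also have "\<dots> = (\<Sum>j<d. \<phi> (g (b j)) * b j)"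
      by (rule sum.reindex_bij_betw[OF b, symmetric])
    also have "\<dots> = \<iota> (vec d (\<lambda>j. g (b j)))" by (simp add: \<iota>_def)
    finally show ?thesis by (intro bexI[of _ "vec d (\<lambda>j. g (b j))"]) auto
  qed
  have "x \<in> \<iota> ` carrier_vec d" for x using surj[of x] by auto
  then have "\<iota> ` carrier_vec d = UNIV" by blast
  \<comment> \<open>The basis has some size d; comparing two counts of the elements of
    \<open>'c\<close> identifies d with l.\<close>
  then have "CARD('c) = CARD('a) ^ d" using card_image[OF inj] by (simp add: card_carrier_vec)
  moreover have "CARD('a) > 1" using card_mono[of "UNIV :: 'a set" "{0, 1}"] by auto
  ultimately have dl: "d = l" using card by simp
  obtain w where w: "\<And>x. w x \<in> carrier_vec d" "\<And>x. \<iota> (w x) = x" using surj by metis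
  \<comment> \<open>Column j holds the coordinates of x times the j-th basis element.\<close>
  define A where "A x = mat d d (\<lambda>(i, j). w (x * b j) $ i)" for x
  have A: "A x \<in> carrier_mat d d" for x by (simp add: A_def)
  have mult: "\<iota> (A x *\<^sub>v v) = x * \<iota> v" if v: "v \<in> carrier_vec d" for x v
  proof -
    have "\<iota> (A x *\<^sub>v v) = (\<Sum>i<d. \<Sum>j<d. \<phi> (w (x * b j) $ i) * \<phi> (v $ j) * b i)"
      using v by (simp add: \<iota>_def A_def scalar_prod_def lessThan_atLeast0 \<phi>.hom_sum \<phi>.hom_mult
          sum_distrib_right)
    also have "\<dots> = (\<Sum>j<d. \<phi> (v $ j) * \<iota> (w (x * b j)))"
      by (subst sum.swap) (simp add: \<iota>_def sum_distrib_left mult_ac)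
    also have "\<dots> = x * \<iota> v" unfolding w(2) by (simp add: \<iota>_def sum_distrib_left mult_ac)
    finally show ?thesis .
  qed
  show thesis
  proof (rule that[of A])
    show "A x \<in> carrier_mat l l" for x using A dl by simp
    fix x y v assume "x \<noteq> y" and v: "v \<in> carrier_vec l" and "A x *\<^sub>v v = A y *\<^sub>v v"
    then have "\<iota> v = 0" using mult[of v x] mult[of v y] dl by simp
    then show "v = 0\<^sub>v l" using inj0[of v] v dl by simp
  qed
qed

section \<open>A spread of q^L + 1 subspaces in the space of pairs of vectors\<close>

lemma vec_add_cancel:
  fixes u :: "'a::field vec"
  assumes u: "u \<in> carrier_vec l" and p: "p \<in> carrier_vec l" and q: "q \<in> carrier_vec l"
    and eq: "u + p = u + q"
  shows "p = q"
proof (rule eq_vecI)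
  fix k assume "k < dim_vec q"
  then have k: "k < l" using q by simp
  have "(u + p) $ k = (u + q) $ k" by (simp only: eq)
  then show "p $ k = q $ k" using k u p q by simp
qed (use p q in simp)

text \<open>The kernels of (u, v) \<mapsto> \<open>A i *\<^sub>v u + B i *\<^sub>v v\<close> are the
  lines through the origin of the plane over GF(q^L): one line u = -c v for every field element c,
  and the line v = 0. Two distinct lines meet only in the origin.\<close>

lemma spread_matrices:
  assumes card: "CARD('c::{field,finite}) = CARD('a::{field,finite}) ^ l"
  obtains A B :: "nat \<Rightarrow> 'a::{field,finite} mat"
  where "\<And>i. A i \<in> carrier_mat l l" and "\<And>i. B i \<in> carrier_mat l l"
    and "\<And>i j u v. i < j \<Longrightarrow> j < CARD('a) ^ l + 1 \<Longrightarrow> u \<in> carrier_vec l \<Longrightarrow> v \<in> carrier_vec l \<Longrightarrow>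
      A i *\<^sub>v u + B i *\<^sub>v v = 0\<^sub>v l \<Longrightarrow> A j *\<^sub>v u + B j *\<^sub>v v = 0\<^sub>v l \<Longrightarrow> u = 0\<^sub>v l \<and> v = 0\<^sub>v l"
proof -
  obtain M :: "'c \<Rightarrow> 'a mat" where M: "\<And>x. M x \<in> carrier_mat l l"
    and M_inj: "\<And>x y v. x \<noteq> y \<Longrightarrow> v \<in> carrier_vec l \<Longrightarrow> M x *\<^sub>v v = M y *\<^sub>v v \<Longrightarrow> v = 0\<^sub>v l"
    by (rule field_extension_matrices[OF card]) blast
  define n where "n = CARD('a) ^ l"
  obtain c :: "nat \<Rightarrow> 'c" where c: "bij_betw c {..<n} UNIV"
    using ex_bij_betw_nat_finite[of "UNIV :: 'c set"] by (auto simp: n_def card lessThan_atLeast0)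
  \<comment> \<open>Indices below n enumerate the slopes; index n is the point at infinity.\<close>
  define A :: "nat \<Rightarrow> 'a mat" where "A i = (if i < n then 1\<^sub>m l else 0\<^sub>m l l)" for i
  define B where "B i = (if i < n then M (c i) else 1\<^sub>m l)" for i
  show thesis
  proof (rule that[of A B])
    show "A i \<in> carrier_mat l l" "B i \<in> carrier_mat l l" for i by (simp_all add: A_def B_def M)
    fix i j u v
    assume ij: "i < j" "j < CARD('a) ^ l + 1" and u: "u \<in> carrier_vec l" and v: "v \<in> carrier_vec l"
      and i0: "A i *\<^sub>v u + B i *\<^sub>v v = 0\<^sub>v l" and j0: "A j *\<^sub>v u + B j *\<^sub>v v = 0\<^sub>v l"
    \<comment> \<open>Because i < j, only j can be the index at infinity, which leaves two cases
      instead of three.\<close>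
    have i: "i < n" using ij by (simp add: n_def)
    have Mv: "M x *\<^sub>v v \<in> carrier_vec l" for x using mult_mat_vec_carrier[OF M v] .
    have iu: "u + M (c i) *\<^sub>v v = 0\<^sub>v l" using i0 i u by (simp add: A_def B_def)
    have v0: "v = 0\<^sub>v l"
    proof (cases "j < n")
      case True
      then have "u + M (c j) *\<^sub>v v = 0\<^sub>v l" using j0 u by (simp add: A_def B_def)
      with iu have *: "u + M (c i) *\<^sub>v v = u + M (c j) *\<^sub>v v" by simp
      have "M (c i) *\<^sub>v v = M (c j) *\<^sub>v v"
        by (rule vec_add_cancel[OF u Mv Mv *])
      moreover have "c i \<noteq> c j" using c ij i True by (auto simp: bij_betw_def inj_on_def)
      ultimately show ?thesis using M_inj v by blast
    next
      case False
      moreover have "0\<^sub>m l l *\<^sub>v u = 0\<^sub>v l" using u by (intro eq_vecI) auto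
      ultimately show ?thesis using j0 v by (simp add: A_def B_def)
    qed
    then have "M (c i) *\<^sub>v v = 0\<^sub>v l" using M[of "c i"] by (intro eq_vecI) auto
    then have "u = 0\<^sub>v l" using iu u by simp
    with v0 show "u = 0\<^sub>v l \<and> v = 0\<^sub>v l" by simp
  qed
qed

section \<open>Rank and decodability\<close>

text \<open>Full row rank means that no nonzero vector is orthogonal to all columns. The matrix need
  not be square, so the determinant criterion is applied to a square matrix made from a maximal
  independent set S of its columns.\<close>

lemma (in vec_space) rank_eq_dim_iff:
  assumes A: "A \<in> carrier_mat n nc"
  shows "rank A = n \<longleftrightarrow>
    (\<forall>y\<in>carrier_vec n. (\<forall>c\<in>set (cols A). c \<bullet> y = 0) \<longrightarrow> y = 0\<^sub>v n)"
proof -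
  have cA: "set (cols A) \<subseteq> carrier_vec n" using cols_dim A by blast
  obtain S where max: "maximal S (\<lambda>T. T \<subseteq> set (cols A) \<and> lin_indpt T)" and finS: "finite S"
    using maximal_exists_superset[of "set (cols A)" "\<lambda>T. T \<subseteq> set (cols A) \<and> lin_indpt T" "{}"]
      lindep_span[of "{}"] by auto
  from max have SA: "S \<subseteq> set (cols A)" and li: "lin_indpt S" by (auto simp: maximal_def)
  have Sc: "S \<subseteq> carrier_vec n" using SA cA by blast
  have rk: "rank A = card S" by (rule rank_card_indpt[OF A max])
  have Sn: "card S \<le> n" using li_le_dim(2)[OF fin_dim _ li] Sc by (simp add: dim_is_n)
  obtain xs where xs: "set xs = S" "distinct xs" using finite_distinct_list[OF finS] by blast
  then have lxs: "length xs = card S" using distinct_card by fastforce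
  \<comment> \<open>Zero columns fill up the square shape without changing which y are orthogonal to
    all columns.\<close>
  define B where "B = mat_of_cols n (xs @ replicate (n - card S) (0\<^sub>v n))"
  have B: "B \<in> carrier_mat n n" 
    using mat_of_cols_carrier(1)[of n "xs @ replicate (n - card S) (0\<^sub>v n)"] Sn lxs
    by (simp add: B_def)
  have colsB: "cols B = xs @ replicate (n - card S) (0\<^sub>v n)"
    unfolding B_def using xs(1) Sc by (intro cols_mat_of_cols) auto
  have Bt: "B\<^sup>T *\<^sub>v y = 0\<^sub>v n \<longleftrightarrow> (\<forall>c\<in>S. c \<bullet> y = 0)" if y: "y \<in> carrier_vec n" for y
  proof -
    have "B\<^sup>T *\<^sub>v y = 0\<^sub>v n \<longleftrightarrow> (\<forall>c\<in>set (cols B). c \<bullet> y = 0)"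
      using B y by (auto simp: vec_eq_iff mult_mat_vec_def cols_def)
    also have "\<dots> \<longleftrightarrow> (\<forall>c\<in>S. c \<bullet> y = 0)"
      using y by (auto simp: colsB xs(1))
    finally show ?thesis .
  qed
  have det_iff: "det B \<noteq> 0 \<longleftrightarrow> (\<forall>y\<in>carrier_vec n. (\<forall>c\<in>S. c \<bullet> y = 0) \<longrightarrow> y = 0\<^sub>v n)"
    using det_0_iff_vec_prod_zero_field[of "B\<^sup>T" n] B Bt by (auto simp: det_transpose[OF B])
  have "rank A = n \<longleftrightarrow> det B \<noteq> 0"
  proof
    assume "rank A = n"
    then have "cols B = xs" by (simp add: colsB rk)
    then have "rank B = n" using lin_indpt_full_rank[OF B] xs li by simp
    then show "det B \<noteq> 0" using det_rank_iff[OF B] by blast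
  next
    assume "det B \<noteq> 0"
    then have rB: "rank B = n" using det_rank_iff[OF B] by blast
    show "rank A = n"
    proof (rule ccontr)
      assume "rank A \<noteq> n"
      with rk Sn have lt: "card S < n" by simp
      have nz: "(UNIV :: 'a set) \<noteq> {0}" by (metis UNIV_I singletonD zero_neq_one)
      \<comment> \<open>A square matrix of full rank has distinct, independent columns, so padding
        by even one zero column is impossible.\<close>
      have "distinct (cols B)" using non_distinct_low_rank[OF B] rB by force
      then have "lin_indpt (set (cols B))" by (rule full_rank_lin_indpt[OF B rB])
      then have "0\<^sub>v n \<notin> set (cols B)"
        using zero_nin_lin_indpt[of "set (cols B)"] cols_dim[of B] B nz by auto
      then show False using lt by (simp add: colsB)
    qed
  qed
  also have "\<dots> \<longleftrightarrow> (\<forall>y\<in>carrier_vec n. (\<forall>c\<in>set (cols A). c \<bullet> y = 0) \<longrightarrow> y = 0\<^sub>v n)"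
  proof -
    \<comment> \<open>By maximality every column lies in the span of S, so orthogonality to S
      extends to all columns.\<close>
    have "c \<bullet> y = 0" if y: "y \<in> carrier_vec n" and S0: "\<forall>c\<in>S. c \<bullet> y = 0" and c: "c \<in> set (cols A)"
      for c y
    proof -
      have "c \<in> span S"
      proof (cases "c \<in> S")
        case True
        then show ?thesis using span_mem[of S c] Sc by simp
      next
        case False
        have "lin_dep (S \<union> {c})"
          using max False SA c unfolding maximal_def by blast
        then show ?thesis using lin_dep_iff_in_span[of S c] Sc li False c cA by auto
      qed
      then obtain a where a: "c = lincomb a S" using finite_in_span[OF finS] Sc by auto
      have "c \<bullet> y = (\<Sum>i<n. (\<Sum>s\<in>S. a s * s $ i) * y $ i)"
        using y by (simp add: scalar_prod_def a lincomb_index[OF _ Sc] lessThan_atLeast0)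
      also have "\<dots> = (\<Sum>s\<in>S. a s * (\<Sum>i<n. s $ i * y $ i))"
        by (simp add: sum_distrib_left sum_distrib_right mult.assoc sum.swap[of _ S])
      also have "\<dots> = (\<Sum>s\<in>S. a s * (s \<bullet> y))"
        using y by (simp add: scalar_prod_def lessThan_atLeast0)
      finally show ?thesis using S0 by simp
    qed
    then show ?thesis unfolding det_iff using SA by blast
  qed
  finally show ?thesis .
qed

lemma rank_concat_kernels_iff:
  assumes F: "\<And>e. e \<in> set es \<Longrightarrow> F e \<in> carrier_mat r l"
  shows "vec_space.rank r (concat_kernels r F es) = r \<longleftrightarrow>
    (\<forall>y\<in>carrier_vec r. (\<forall>e\<in>set es. (F e)\<^sup>T *\<^sub>v y = 0\<^sub>v l) \<longrightarrow> y = 0\<^sub>v r)"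
proof -
  let ?cs = "concat (map (\<lambda>e. cols (F e)) es)"
  have cs: "set ?cs \<subseteq> carrier_vec r" 
  proof
    fix c assume "c \<in> set ?cs"
    then obtain e where "e \<in> set es" "c \<in> set (cols (F e))" by auto
    then show "c \<in> carrier_vec r" using F[of e] cols_dim[of "F e"] by auto
  qed
  have "concat_kernels r F es \<in> carrier_mat r (length ?cs)"
    by (simp add: concat_kernels_def)
  then have *: "vec_space.rank r (concat_kernels r F es) = r \<longleftrightarrow>
    (\<forall>y\<in>carrier_vec r. (\<forall>c\<in>set ?cs. c \<bullet> y = 0) \<longrightarrow> y = 0\<^sub>v r)"
    using vec_space.rank_eq_dim_iff cols_mat_of_cols[OF cs] by (metis concat_kernels_def)
  have **: "(\<forall>c\<in>set ?cs. c \<bullet> y = 0) \<longleftrightarrow> (\<forall>e\<in>set es. (F e)\<^sup>T *\<^sub>v y = 0\<^sub>v l)" for y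
  proof -
    have "(\<forall>c\<in>set (cols (F e)). c \<bullet> y = 0) \<longleftrightarrow> (F e)\<^sup>T *\<^sub>v y = 0\<^sub>v l" if "e \<in> set es" for e
      using F[OF that] by (auto simp: vec_eq_iff mult_mat_vec_def cols_def)
    then show ?thesis by auto
  qed
  show ?thesis using * unfolding ** .
qed

section \<open>Solutions read as flows of messages\<close>

lemma in_edges_subset: "in_edges N v \<subseteq> edges N" and out_edges_subset: "out_edges N v \<subseteq> edges N"
  by (auto simp: in_edges_def out_edges_def)

text \<open>In the decoding form the incoming edges matter only as a set, so the existentially
  chosen ordering \<open>es\<close> disappears; finiteness supplies one for the converse.\<close>

lemma vec_lin_solution_iff:
  assumes "finite (edges N)"
  shows "vec_lin_solution N l K F \<longleftrightarrow> vec_lin_code N l K \<and> global_kernels N l K F \<and>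
    (\<forall>t\<in>receivers N. \<forall>y\<in>carrier_vec (source_dim N * l).
      (\<forall>e\<in>in_edges N t. (F e)\<^sup>T *\<^sub>v y = 0\<^sub>v l) \<longrightarrow> y = 0\<^sub>v (source_dim N * l))"
proof -
  let ?r = "source_dim N * l"
  have "(\<exists>es. distinct es \<and> set es = in_edges N t \<and> vec_space.rank ?r (concat_kernels ?r F es) = ?r)
    \<longleftrightarrow> (\<forall>y\<in>carrier_vec ?r. (\<forall>e\<in>in_edges N t. (F e)\<^sup>T *\<^sub>v y = 0\<^sub>v l) \<longrightarrow> y = 0\<^sub>v ?r)"
    if F: "\<forall>e\<in>edges N. F e \<in> carrier_mat ?r l" for t
  proof -
    have "finite (in_edges N t)" using assms in_edges_subset finite_subset by metis
    then obtain es where "set es = in_edges N t" "distinct es" using finite_distinct_list by blast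
    moreover have "vec_space.rank ?r (concat_kernels ?r F es) = ?r \<longleftrightarrow>
      (\<forall>y\<in>carrier_vec ?r. (\<forall>e\<in>in_edges N t. (F e)\<^sup>T *\<^sub>v y = 0\<^sub>v l) \<longrightarrow> y = 0\<^sub>v ?r)"
      if "set es = in_edges N t" for es
      using rank_concat_kernels_iff[of es F ?r l] F that in_edges_subset[of N t] by auto
    ultimately show ?thesis by blast
  qed
  moreover have "\<forall>e\<in>edges N. F e \<in> carrier_mat ?r l" if "global_kernels N l K F"
    using that by (simp add: global_kernels_def Let_def)
  ultimately show ?thesis unfolding vec_lin_solution_def by blast
qed

lemma transpose_mult_vec_index:
  fixes A :: "'a::comm_ring_1 mat"
  assumes "A \<in> carrier_mat r l" "y \<in> carrier_vec r" "j < l"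
  shows "(A\<^sup>T *\<^sub>v y) $ j = (\<Sum>i<r. A $$ (i, j) * y $ i)"
  using assms by (simp add: scalar_prod_def lessThan_atLeast0)

text \<open>Transposition reverses the products \<open>F d * K d e\<close>, so each node applies the
  transposed local kernels to its incoming messages and adds up. The entrywise form matches the sum
  in \<open>global_kernels\<close>.\<close>

lemma message_recursion:
  assumes fin: "finite (edges N)" and code: "vec_lin_code N l K" and gk: "global_kernels N l K F"
    and v: "v \<in> nodes N" "v \<noteq> source N" and e: "e \<in> out_edges N v"
    and y: "y \<in> carrier_vec (source_dim N * l)" and j: "j < l"
  shows "((F e)\<^sup>T *\<^sub>v y) $ j = (\<Sum>d\<in>in_edges N v. ((K d e)\<^sup>T *\<^sub>v ((F d)\<^sup>T *\<^sub>v y)) $ j)"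
proof -
  let ?r = "source_dim N * l"
  have F: "F d \<in> carrier_mat ?r l" if "d \<in> in_edges N v" for d
    using gk that in_edges_subset[of N v] by (auto simp: global_kernels_def Let_def)
  have K: "K d e \<in> carrier_mat l l" for d using code by (simp add: vec_lin_code_def)
  have Fe: "F e = mat ?r l (\<lambda>(i, j). \<Sum>d\<in>in_edges N v. (F d * K d e) $$ (i, j))"
    using gk v e by (simp add: global_kernels_def Let_def)
  have "((F e)\<^sup>T *\<^sub>v y) $ j = (\<Sum>i<?r. (\<Sum>d\<in>in_edges N v. (F d * K d e) $$ (i, j)) * y $ i)"
    using y j by (subst Fe) (simp add: scalar_prod_def lessThan_atLeast0)
  also have "\<dots> = (\<Sum>d\<in>in_edges N v. \<Sum>i<?r. (F d * K d e) $$ (i, j) * y $ i)"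
    by (subst sum.swap) (simp add: sum_distrib_right)
  also have "\<dots> = (\<Sum>d\<in>in_edges N v. ((K d e)\<^sup>T *\<^sub>v ((F d)\<^sup>T *\<^sub>v y)) $ j)"
  proof (rule sum.cong[OF refl])
    fix d assume d: "d \<in> in_edges N v"
    have "(K d e)\<^sup>T *\<^sub>v ((F d)\<^sup>T *\<^sub>v y) = (F d * K d e)\<^sup>T *\<^sub>v y"
      using F[OF d] K[of d] y
      by (simp add: transpose_mult[of _ ?r l _ l] assoc_mult_mat_vec[of _ l l _ ?r])
    also have "\<dots> $ j = (\<Sum>i<?r. (F d * K d e) $$ (i, j) * y $ i)"
      by (rule transpose_mult_vec_index[OF mult_carrier_mat[OF F[OF d] K[of d]] y j])
    finally show "(\<Sum>i<?r. (F d * K d e) $$ (i, j) * y $ i) = ((K d e)\<^sup>T *\<^sub>v ((F d)\<^sup>T *\<^sub>v y)) $ j" by simp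
  qed
  finally show ?thesis .
qed

text \<open>Multiplying all global kernels by one matrix on the left respects the local recursion.
  This is what allows the source coordinates to be changed in
  \<open>subnetwork_solvable\<close>.\<close>

lemma mult_mat_kernel_sum:
  assumes D: "D \<in> carrier_mat m n" and F: "\<And>d. d \<in> S \<Longrightarrow> F d \<in> carrier_mat n l"
    and K: "\<And>d. d \<in> S \<Longrightarrow> K d \<in> carrier_mat l l"
  shows "D * mat n l (\<lambda>(i, j). \<Sum>d\<in>S. (F d * K d) $$ (i, j)) =
    mat m l (\<lambda>(i, j). \<Sum>d\<in>S. ((D * F d) * K d) $$ (i, j))"
proof (rule eq_matI)
  fix i j assume "i < dim_row (mat m l (\<lambda>(i, j). \<Sum>d\<in>S. ((D * F d) * K d) $$ (i, j)))"
    "j < dim_col (mat m l (\<lambda>(i, j). \<Sum>d\<in>S. ((D * F d) * K d) $$ (i, j)))"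
  then have i: "i < m" and j: "j < l" by simp_all
  have "(D * mat n l (\<lambda>(i, j). \<Sum>d\<in>S. (F d * K d) $$ (i, j))) $$ (i, j)
    = (\<Sum>k<n. \<Sum>d\<in>S. D $$ (i, k) * (F d * K d) $$ (k, j))"
    using D i j by (simp add: scalar_prod_def lessThan_atLeast0 sum_distrib_left)
  also have "\<dots> = (\<Sum>d\<in>S. \<Sum>k<n. D $$ (i, k) * (F d * K d) $$ (k, j))"
    by (rule sum.swap)
  also have "\<dots> = (\<Sum>d\<in>S. ((D * F d) * K d) $$ (i, j))"
  proof (rule sum.cong[OF refl])
    fix d assume d: "d \<in> S"
    have "(D * F d) * K d = D * (F d * K d)" using D F[OF d] K[OF d] by (simp add: assoc_mult_mat)
    also have "\<dots> $$ (i, j) = (\<Sum>k<n. D $$ (i, k) * (F d * K d) $$ (k, j))"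
    proof -
      have "dim_row (F d * K d) = n" "dim_col (F d * K d) = l" using F[OF d] K[OF d] by auto
      then show ?thesis using D i j
        by (subst index_mult_mat(1)) (auto simp: scalar_prod_def lessThan_atLeast0 simp del: index_mult_mat(1))
    qed
    finally show "(\<Sum>k<n. D $$ (i, k) * (F d * K d) $$ (k, j)) = ((D * F d) * K d) $$ (i, j)" by simp
  qed
  finally show "(D * mat n l (\<lambda>(i, j). \<Sum>d\<in>S. (F d * K d) $$ (i, j))) $$ (i, j) =
    mat m l (\<lambda>(i, j). \<Sum>d\<in>S. ((D * F d) * K d) $$ (i, j)) $$ (i, j)"
    using i j by simp
qed (use D in auto)

text \<open>A homomorphism applied entrywise commutes with the sums and products of the recursion
  and fixes 0 and 1, so all kernel equations carry over.\<close>

lemma vec_lin_solvable_field_iso: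
  fixes \<phi> :: "'b::field \<Rightarrow> 'c::field"
  assumes hom: "field_hom \<phi>" and bij: "bij \<phi>" and fin: "finite (edges N)"
    and sol: "vec_lin_solvable TYPE('b) N l"
  shows "vec_lin_solvable TYPE('c) N l"
proof -
  interpret field_hom \<phi> by (rule hom)
  obtain K and F :: "_ \<Rightarrow> 'b mat" where "vec_lin_solution N l K F"
    using sol by (auto simp: vec_lin_solvable_def)
  then have code: "vec_lin_code N l K" and gk: "global_kernels N l K F"
    and dec: "\<forall>t\<in>receivers N. \<forall>y\<in>carrier_vec (source_dim N * l).
      (\<forall>e\<in>in_edges N t. (F e)\<^sup>T *\<^sub>v y = 0\<^sub>v l) \<longrightarrow> y = 0\<^sub>v (source_dim N * l)"
    by (simp_all add: vec_lin_solution_iff[OF fin])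
  let ?r = "source_dim N * l"
  have F: "F e \<in> carrier_mat ?r l" if "e \<in> edges N" for e
    using gk that by (auto simp: global_kernels_def Let_def)
  have K: "K d e \<in> carrier_mat l l" for d e using code by (simp add: vec_lin_code_def)
  define K' F' where "K' d e = map_mat \<phi> (K d e)" and "F' e = map_mat \<phi> (F e)" for d e
  have "vec_lin_code N l K'"
  proof -
    have "map_mat \<phi> (0\<^sub>m l l) = 0\<^sub>m l l" by (rule eq_matI) auto
    then show ?thesis using code by (auto simp: vec_lin_code_def K'_def)
  qed
  moreover have "global_kernels N l K' F'"
    unfolding global_kernels_def Let_def
  proof (intro conjI ballI)
    show "F' e \<in> carrier_mat ?r l" if "e \<in> edges N" for e
      using F[OF that] by (simp add: F'_def)
    obtain idx where idx: "bij_betw idx (out_edges N (source N)) {..<source_dim N}"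
      and id: "\<And>e i j. e \<in> out_edges N (source N) \<Longrightarrow> i < ?r \<Longrightarrow> j < l \<Longrightarrow>
        F e $$ (i, j) = (if i = idx e * l + j then 1 else 0)"
      using gk by (auto simp: global_kernels_def Let_def)
    show "\<exists>idx. bij_betw idx (out_edges N (source N)) {..<source_dim N} \<and>
        (\<forall>e\<in>out_edges N (source N). \<forall>i<?r. \<forall>j<l.
           F' e $$ (i, j) = (if i = idx e * l + j then 1 else 0))"
    proof (intro exI conjI ballI allI impI)
      fix e i j assume e: "e \<in> out_edges N (source N)" and ij: "i < ?r" "j < l"
      have "F e \<in> carrier_mat ?r l" by (rule F[OF subsetD[OF out_edges_subset e]])
      then show "F' e $$ (i, j) = (if i = idx e * l + j then 1 else 0)"
        using ij id[OF e ij] by (simp add: F'_def)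
    qed (rule idx)
    fix v e assume v: "v \<in> nodes N - {source N}" and e: "e \<in> out_edges N v"
    have Fe: "F e = mat ?r l (\<lambda>(i, j). \<Sum>d\<in>in_edges N v. (F d * K d e) $$ (i, j))"
      using gk v e by (simp add: global_kernels_def Let_def)
    show "F' e = mat ?r l (\<lambda>(i, j). \<Sum>d\<in>in_edges N v. (F' d * K' d e) $$ (i, j))"
    proof (rule eq_matI)
      fix i j assume "i < dim_row (mat ?r l (\<lambda>(i, j). \<Sum>d\<in>in_edges N v. (F' d * K' d e) $$ (i, j)))"
        "j < dim_col (mat ?r l (\<lambda>(i, j). \<Sum>d\<in>in_edges N v. (F' d * K' d e) $$ (i, j)))"
      then have ij: "i < ?r" "j < l" by simp_all
      have "(F' d * K' d e) $$ (i, j) = \<phi> ((F d * K d e) $$ (i, j))" if "d \<in> in_edges N v" for d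
      proof -
        have Fd: "F d \<in> carrier_mat ?r l" by (rule F[OF subsetD[OF in_edges_subset that]])
        have "F' d * K' d e = map_mat \<phi> (F d * K d e)"
          unfolding F'_def K'_def by (rule mat_hom_mult[OF Fd K, symmetric])
        then show ?thesis using Fd K[of d e] ij by (simp del: index_mult_mat(1))
      qed
      then show "F' e $$ (i, j) = mat ?r l (\<lambda>(i, j). \<Sum>d\<in>in_edges N v. (F' d * K' d e) $$ (i, j)) $$ (i, j)"
        using ij by (simp add: F'_def Fe hom_sum del: index_mult_mat(1))
    qed (simp_all add: F'_def Fe)
  qed
  moreover have "y = 0\<^sub>v ?r" if t: "t \<in> receivers N" and y: "y \<in> carrier_vec ?r"
    and z: "\<forall>e\<in>in_edges N t. (F' e)\<^sup>T *\<^sub>v y = 0\<^sub>v l" for t y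
  proof -
    \<comment> \<open>Surjectivity of \<phi> is used here: a message over \<open>'c\<close> is
      pulled back to one over \<open>'b\<close>, where decodability is known.\<close>
    define x where "x = map_vec (inv_into UNIV \<phi>) y"
    have x: "x \<in> carrier_vec ?r" using y by (simp add: x_def)
    have yx: "y = map_vec \<phi> x"
      using bij by (intro eq_vecI) (simp_all add: x_def bij_is_surj surj_f_inv_f)
    have "(F e)\<^sup>T *\<^sub>v x = 0\<^sub>v l" if e: "e \<in> in_edges N t" for e
    proof -
      have Fe: "F e \<in> carrier_mat ?r l" by (rule F[OF subsetD[OF in_edges_subset e]])
      have "map_vec \<phi> ((F e)\<^sup>T *\<^sub>v x) = map_mat \<phi> ((F e)\<^sup>T) *\<^sub>v map_vec \<phi> x"
        using mult_mat_vec_hom[of "(F e)\<^sup>T" l ?r x] Fe x by simp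
      also have "map_mat \<phi> ((F e)\<^sup>T) = (F' e)\<^sup>T" by (simp add: F'_def map_mat_transpose)
      finally have *: "map_vec \<phi> ((F e)\<^sup>T *\<^sub>v x) = 0\<^sub>v l" using z e yx by simp
      show ?thesis
      proof (rule eq_vecI)
        fix j assume "j < dim_vec (0\<^sub>v l :: 'b vec)"
        then have j: "j < l" by simp
        then have "\<phi> (((F e)\<^sup>T *\<^sub>v x) $ j) = 0"
          using arg_cong[OF *, of "\<lambda>v. v $ j"] Fe by simp
        then show "((F e)\<^sup>T *\<^sub>v x) $ j = 0\<^sub>v l $ j" using j by simp
      qed (use Fe in simp)
    qed
    then have "x = 0\<^sub>v ?r" using dec t x by blast
    then show "y = 0\<^sub>v ?r" unfolding yx by (intro eq_vecI) auto
  qed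
  ultimately show ?thesis
    unfolding vec_lin_solvable_def vec_lin_solution_iff[OF fin] by blast
qed

section \<open>The combined network\<close>

text \<open>Such maps form an orthogonal array of strength 2 and index 1, or a net of order |V| with
  m parallel classes; the bound is the classical one that limits mutually orthogonal Latin
  squares.\<close>

lemma pairwise_injective_card_bound:
  fixes h :: "nat \<Rightarrow> 'p \<Rightarrow> 'x"
  assumes V: "finite V" "card V \<ge> 2" and P: "finite P" "card P = card V * card V"
    and range: "\<And>i p. i < m \<Longrightarrow> p \<in> P \<Longrightarrow> h i p \<in> V"
    and inj: "\<And>i j. i < j \<Longrightarrow> j < m \<Longrightarrow> inj_on (\<lambda>p. (h i p, h j p)) P"
  shows "m \<le> card V + 1"
proof (cases "m < 2")
  case True
  then show ?thesis by simp
next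
  case False
  have inj': "p = q" if "i \<noteq> j" "i < m" "j < m" "p \<in> P" "q \<in> P" "h i p = h i q" "h j p = h j q" for i j p q
    using that inj[of i j] inj[of j i] by (cases "i < j") (auto simp: inj_on_def)
  have "card P > 0" using V(2) P(2) by simp
  then obtain p0 where p0: "p0 \<in> P" by (metis card_gt_0_iff ex_in_conv)
  define S where "S i = {p \<in> P. h i p = h i p0}" for i
  have cS: "card (S i) = card V" if i: "i < m" for i
  proof -
    \<comment> \<open>Any second index will do; m \<ge> 2 provides one. The pair (h_i, h_j) is a
      bijection onto V x V by counting, so h_j maps the fibre of h_i bijectively onto V.\<close>
    define j where "j = (if i = 0 then 1 else 0 :: nat)"
    then have j: "j < m" "j \<noteq> i" using False by auto
    let ?g = "\<lambda>p. (h i p, h j p)"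
    have ig: "inj_on ?g P" using inj'[of i j] i j by (auto simp: inj_on_def)
    have "?g ` P = V \<times> V"
      using range i j V P by (intro card_subset_eq) (auto simp: card_image[OF ig] card_cartesian_product)
    have "h j ` S i = V"
    proof
      show "h j ` S i \<subseteq> V" using range j by (auto simp: S_def)
      show "V \<subseteq> h j ` S i"
      proof
        fix v assume "v \<in> V"
        then have "(h i p0, v) \<in> ?g ` P" unfolding \<open>?g ` P = V \<times> V\<close> using range i p0 by simp
        then show "v \<in> h j ` S i" by (auto simp: S_def)
      qed
    qed
    moreover have "inj_on (h j) (S i)" using inj'[of i j] i j by (auto simp: inj_on_def S_def)
    ultimately show ?thesis using card_image by metis
  qed
  have "card (\<Union>i<m. S i - {p0}) = (\<Sum>i<m. card (S i - {p0}))"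
  proof (rule card_UN_disjoint)
    show "\<forall>i\<in>{..<m}. finite (S i - {p0})" using P by (simp add: S_def)
    show "\<forall>i\<in>{..<m}. \<forall>j\<in>{..<m}. i \<noteq> j \<longrightarrow> (S i - {p0}) \<inter> (S j - {p0}) = {}"
    proof (intro ballI impI)
      fix i j assume "i \<in> {..<m}" "j \<in> {..<m}" "i \<noteq> j"
      then show "(S i - {p0}) \<inter> (S j - {p0}) = {}"
        using inj'[of i j _ p0] p0 by (auto simp: S_def)
    qed
  qed simp
  also have "\<dots> = m * (card V - 1)"
  proof -
    have "card (S i - {p0}) = card V - 1" if "i < m" for i
      using cS[OF that] p0 by (subst card_Diff_singleton) (auto simp: S_def)
    then show ?thesis by simp
  qed
  finally have "m * (card V - 1) \<le> card (P - {p0})"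
    using card_mono[of "P - {p0}" "\<Union>i<m. S i - {p0}"] P by (auto simp: S_def)
  also have "\<dots> = card V * card V - 1" using p0 P by simp
  finally have bound: "m * (card V - 1) \<le> card V * card V - 1" .
  \<comment> \<open>With this substitution |V|^2 - 1 factors as (k + 3)(k + 1), and the positive
    factor k + 1 cancels without natural subtraction.\<close>
  obtain k where k: "card V = k + 2" using V(2) le_Suc_ex by (metis add.commute)
  have "m * (k + 1) \<le> (k + 3) * (k + 1)" using bound by (simp add: k algebra_simps)
  then have "m \<le> k + 3" unfolding mult_le_cancel2 by simp
  then show ?thesis by (simp add: k)
qed

section \<open>Incidence structure of the combined network and of the combination network\<close>

lemma construct_network_simps:
  "source (construct_network N1 N2 w) = NSrc'"
  "nodes (construct_network N1 N2 w) = {NSrc', NS} \<union> V1 ` nodes N1 \<union> V2 ` nodes N2"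
  "receivers (construct_network N1 N2 w) = V1 ` receivers N1 \<union> V2 ` receivers N2"
  by (simp_all add: construct_network_def)

lemma construct_network_edges:
  "ETop i \<in> edges (construct_network N1 N2 w) \<longleftrightarrow> i < w"
  "EToS1 i \<in> edges (construct_network N1 N2 w) \<longleftrightarrow> i < w"
  "EToS2 i \<in> edges (construct_network N1 N2 w) \<longleftrightarrow> i < 2"
  "EToT t i \<in> edges (construct_network N1 N2 w) \<longleftrightarrow> t \<in> receivers N2 \<and> i < w - 2"
  "F1 d \<in> edges (construct_network N1 N2 w) \<longleftrightarrow> d \<in> edges N1"
  "F2 e \<in> edges (construct_network N1 N2 w) \<longleftrightarrow> e \<in> edges N2"
  by (auto simp: construct_network_def)

lemma construct_network_ends:
  "etail (construct_network N1 N2 w) (ETop i) = NSrc'"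
  "etail (construct_network N1 N2 w) (EToS1 i) = NS"
  "etail (construct_network N1 N2 w) (EToS2 i) = NS"
  "etail (construct_network N1 N2 w) (EToT t i) = NS"
  "etail (construct_network N1 N2 w) (F1 d) = V1 (etail N1 d)"
  "etail (construct_network N1 N2 w) (F2 e) = V2 (etail N2 e)"
  "ehead (construct_network N1 N2 w) (ETop i) = NS"
  "ehead (construct_network N1 N2 w) (EToS1 i) = V1 (source N1)"
  "ehead (construct_network N1 N2 w) (EToS2 i) = V2 (source N2)"
  "ehead (construct_network N1 N2 w) (EToT t i) = V2 t"
  "ehead (construct_network N1 N2 w) (F1 d) = V1 (ehead N1 d)"
  "ehead (construct_network N1 N2 w) (F2 e) = V2 (ehead N2 e)"
  by (simp_all add: construct_network_def)

lemma construct_network_out_edges: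
  "out_edges (construct_network N1 N2 w) NSrc' = ETop ` {..<w}"
  "out_edges (construct_network N1 N2 w) NS = EToS1 ` {..<w} \<union> EToS2 ` {..<2} \<union>
    {EToT t i | t i. t \<in> receivers N2 \<and> i < w - 2}"
  "out_edges (construct_network N1 N2 w) (V1 v) = F1 ` out_edges N1 v"
  "out_edges (construct_network N1 N2 w) (V2 v') = F2 ` out_edges N2 v'"
proof -
  show "out_edges (construct_network N1 N2 w) NSrc' = ETop ` {..<w}"
  proof (rule Set.set_eqI)
    show "x \<in> out_edges (construct_network N1 N2 w) NSrc' \<longleftrightarrow> x \<in> (ETop ` {..<w})" for x
      by (cases x) (auto simp: out_edges_def construct_network_edges construct_network_ends)
  qed
  show "out_edges (construct_network N1 N2 w) NS = EToS1 ` {..<w} \<union> EToS2 ` {..<2} \<union>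
    {EToT t i | t i. t \<in> receivers N2 \<and> i < w - 2}"
  proof (rule Set.set_eqI)
    show "x \<in> out_edges (construct_network N1 N2 w) NS \<longleftrightarrow> x \<in> (EToS1 ` {..<w} \<union> EToS2 ` {..<2} \<union>
    {EToT t i | t i. t \<in> receivers N2 \<and> i < w - 2})" for x
      by (cases x) (auto simp: out_edges_def construct_network_edges construct_network_ends)
  qed
  show "out_edges (construct_network N1 N2 w) (V1 v) = F1 ` out_edges N1 v"
  proof (rule Set.set_eqI)
    show "x \<in> out_edges (construct_network N1 N2 w) (V1 v) \<longleftrightarrow> x \<in> (F1 ` out_edges N1 v)" for x
      by (cases x) (auto simp: out_edges_def construct_network_edges construct_network_ends)
  qed
  show "out_edges (construct_network N1 N2 w) (V2 v') = F2 ` out_edges N2 v'"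
  proof (rule Set.set_eqI)
    show "x \<in> out_edges (construct_network N1 N2 w) (V2 v') \<longleftrightarrow> x \<in> (F2 ` out_edges N2 v')" for x
      by (cases x) (auto simp: out_edges_def construct_network_edges construct_network_ends)
  qed
qed

lemma construct_network_in_edges:
  "in_edges (construct_network N1 N2 w) NS = ETop ` {..<w}"
  "in_edges (construct_network N1 N2 w) (V1 v) =
    F1 ` in_edges N1 v \<union> (if v = source N1 then EToS1 ` {..<w} else {})"
  "in_edges (construct_network N1 N2 w) (V2 v') =
    F2 ` in_edges N2 v' \<union> (if v' = source N2 then EToS2 ` {..<2} else {}) \<union>
    (if v' \<in> receivers N2 then EToT v' ` {..<w - 2} else {})"
proof -
  show "in_edges (construct_network N1 N2 w) NS = ETop ` {..<w}"
  proof (rule Set.set_eqI)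
    show "x \<in> in_edges (construct_network N1 N2 w) NS \<longleftrightarrow> x \<in> (ETop ` {..<w})" for x
      by (cases x) (auto simp: in_edges_def construct_network_edges construct_network_ends)
  qed
  show "in_edges (construct_network N1 N2 w) (V1 v) =
    F1 ` in_edges N1 v \<union> (if v = source N1 then EToS1 ` {..<w} else {})"
  proof (rule Set.set_eqI)
    show "x \<in> in_edges (construct_network N1 N2 w) (V1 v) \<longleftrightarrow> x \<in> (F1 ` in_edges N1 v \<union> (if v = source N1 then EToS1 ` {..<w} else {}))" for x
      by (cases x) (auto simp: in_edges_def construct_network_edges construct_network_ends)
  qed
  show "in_edges (construct_network N1 N2 w) (V2 v') =
    F2 ` in_edges N2 v' \<union> (if v' = source N2 then EToS2 ` {..<2} else {}) \<union>
    (if v' \<in> receivers N2 then EToT v' ` {..<w - 2} else {})"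
  proof (rule Set.set_eqI)
    show "x \<in> in_edges (construct_network N1 N2 w) (V2 v') \<longleftrightarrow> x \<in> (F2 ` in_edges N2 v' \<union> (if v' = source N2 then EToS2 ` {..<2} else {}) \<union>
    (if v' \<in> receivers N2 then EToT v' ` {..<w - 2} else {}))" for x
      by (cases x) (auto simp: in_edges_def construct_network_edges construct_network_ends)
  qed
qed

lemma source_dim_construct_network: "source_dim (construct_network N1 N2 w) = w"
  by (simp add: source_dim_def construct_network_simps construct_network_out_edges card_image inj_on_def)

lemma finite_edges_construct_network:
  assumes "finite (edges N1)" "finite (edges N2)" "finite (receivers N2)"
  shows "finite (edges (construct_network N1 N2 w))"
proof -
  have "edges (construct_network N1 N2 w) = ETop ` {..<w} \<union> EToS1 ` {..<w} \<union> EToS2 ` {..<2} \<union>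
    (\<lambda>(t, i). EToT t i) ` (receivers N2 \<times> {..<w - 2}) \<union> F1 ` edges N1 \<union> F2 ` edges N2"
    by (auto simp: construct_network_def)
  then show ?thesis using assms by simp
qed

lemma comb_network_simps:
  "source (comb_network m) = CSrc"
  "nodes (comb_network m) = {CSrc} \<union> CMid ` {..<m} \<union> {CRcv i j | i j. i < j \<and> j < m}"
  "receivers (comb_network m) = {CRcv i j | i j. i < j \<and> j < m}"
  by (simp_all add: comb_network_def)

lemma comb_network_edges:
  "CEs i \<in> edges (comb_network m) \<longleftrightarrow> i < m"
  "CEr i j \<in> edges (comb_network m) \<longleftrightarrow> i \<noteq> j \<and> i < m \<and> j < m"
  by (auto simp: comb_network_def)

lemma comb_network_ends:
  "etail (comb_network m) (CEs i) = CSrc"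
  "etail (comb_network m) (CEr i j) = CMid i"
  "ehead (comb_network m) (CEs i) = CMid i"
  "ehead (comb_network m) (CEr i j) = CRcv (min i j) (max i j)"
  by (simp_all add: comb_network_def)

lemma comb_network_out_edges:
  "out_edges (comb_network m) CSrc = CEs ` {..<m}"
  "out_edges (comb_network m) (CMid i) = {CEr i j | j. i \<noteq> j \<and> i < m \<and> j < m}"
  "out_edges (comb_network m) (CRcv i j) = {}"
proof -
  show "out_edges (comb_network m) CSrc = CEs ` {..<m}"
  proof (rule Set.set_eqI)
    show "x \<in> out_edges (comb_network m) CSrc \<longleftrightarrow> x \<in> (CEs ` {..<m})" for x
      by (cases x) (auto simp: out_edges_def comb_network_edges comb_network_ends)
  qed
  show "out_edges (comb_network m) (CMid i) = {CEr i j | j. i \<noteq> j \<and> i < m \<and> j < m}"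
  proof (rule Set.set_eqI)
    show "x \<in> out_edges (comb_network m) (CMid i) \<longleftrightarrow> x \<in> ({CEr i j | j. i \<noteq> j \<and> i < m \<and> j < m})" for x
      by (cases x) (auto simp: out_edges_def comb_network_edges comb_network_ends)
  qed
  show "out_edges (comb_network m) (CRcv i j) = {}"
  proof (rule Set.set_eqI)
    show "x \<in> out_edges (comb_network m) (CRcv i j) \<longleftrightarrow> x \<in> {}" for x
      by (cases x) (auto simp: out_edges_def comb_network_edges comb_network_ends)
  qed
qed

lemma comb_network_in_edges:
  "in_edges (comb_network m) CSrc = {}"
  "i < m \<Longrightarrow> in_edges (comb_network m) (CMid i) = {CEs i}"
  "i < j \<Longrightarrow> j < m \<Longrightarrow> in_edges (comb_network m) (CRcv i j) = {CEr i j, CEr j i}"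
proof -
  show "in_edges (comb_network m) CSrc = {}"
  proof (rule Set.set_eqI)
    show "x \<in> in_edges (comb_network m) CSrc \<longleftrightarrow> x \<in> {}" for x
      by (cases x) (auto simp: in_edges_def comb_network_edges comb_network_ends min_def max_def split: if_splits)
  qed
  show "in_edges (comb_network m) (CMid i) = {CEs i}" if "i < m"
  proof (rule Set.set_eqI)
    show "x \<in> in_edges (comb_network m) (CMid i) \<longleftrightarrow> x \<in> ({CEs i})" for x
      using that by (cases x) (auto simp: in_edges_def comb_network_edges comb_network_ends min_def max_def split: if_splits)
  qed
  show "in_edges (comb_network m) (CRcv i j) = {CEr i j, CEr j i}" if "i < j" "j < m"
  proof (rule Set.set_eqI)
    show "x \<in> in_edges (comb_network m) (CRcv i j) \<longleftrightarrow> x \<in> ({CEr i j, CEr j i})" for x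
      using that by (cases x) (auto simp: in_edges_def comb_network_edges comb_network_ends min_def max_def split: if_splits)
  qed
qed

lemma finite_comb_network: "finite (edges (comb_network m))" "finite (receivers (comb_network m))"
proof -
  have "edges (comb_network m) \<subseteq> CEs ` {..<m} \<union> (\<lambda>(i, j). CEr i j) ` ({..<m} \<times> {..<m})"
    by (auto simp: comb_network_def)
  then show "finite (edges (comb_network m))" by (rule finite_subset) simp
  have "receivers (comb_network m) \<subseteq> (\<lambda>(i, j). CRcv i j) ` ({..<m} \<times> {..<m})"
    by (auto simp: comb_network_def)
  then show "finite (receivers (comb_network m))" by (rule finite_subset) simp
qed

text \<open>Beyond the message recursion, linearity serves only to turn a trivial kernel into
  injectivity; everything else counts elements of finite sets.\<close>

lemma comb_network_solvable_bound:
  assumes fin: "finite (edges N1)" and w: "w \<ge> 2" and l: "l \<ge> 1"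
    and sol: "vec_lin_solvable TYPE('d::{field,finite}) (construct_network N1 (comb_network m) w) l"
  shows "m \<le> CARD('d) ^ l + 1"
proof -
  define N where "N = construct_network N1 (comb_network m) w"
  have sd: "source_dim N = w" unfolding N_def by (rule source_dim_construct_network)
  have finN: "finite (edges N)"
    unfolding N_def by (intro finite_edges_construct_network fin finite_comb_network)
  obtain K and F :: "_ \<Rightarrow> 'd mat" where "vec_lin_solution N l K F"
    using sol by (auto simp: vec_lin_solvable_def N_def)
  then have code: "vec_lin_code N l K" and gk: "global_kernels N l K F"
    and dec: "\<And>t y. t \<in> receivers N \<Longrightarrow> y \<in> carrier_vec (w * l) \<Longrightarrow>
      (\<forall>e\<in>in_edges N t. (F e)\<^sup>T *\<^sub>v y = 0\<^sub>v l) \<Longrightarrow> y = 0\<^sub>v (w * l)"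
    by (simp_all add: vec_lin_solution_iff[OF finN] sd)
  define V :: "'d vec set" where "V = carrier_vec l"
  define Y :: "'d vec set" where "Y = carrier_vec (w * l)"
  have Kc: "K d e \<in> carrier_mat l l" for d e using code by (simp add: vec_lin_code_def)
  have Fc: "F e \<in> carrier_mat (w * l) l" if "e \<in> edges N" for e
    using gk that by (simp add: global_kernels_def Let_def sd)
  define msg where "msg e y = (F e)\<^sup>T *\<^sub>v y" for e y
  have msgV: "msg e y \<in> V" if "e \<in> edges N" "y \<in> Y" for e y
    using Fc[OF that(1)] that(2) by (simp add: msg_def V_def Y_def)
  have KV: "(K d e)\<^sup>T *\<^sub>v x \<in> V" if "x \<in> V" for d e x
    using Kc[of d e] that by (simp add: V_def)
  have rec: "msg e y $ k = (\<Sum>d\<in>in_edges N v. ((K d e)\<^sup>T *\<^sub>v msg d y) $ k)"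
    if "v \<in> nodes N" "v \<noteq> source N" "e \<in> out_edges N v" "y \<in> Y" "k < l" for v e y k
    using message_recursion[OF finN code gk that(1-3) _ that(5), of y] that(4)
    by (simp add: msg_def Y_def sd)
  \<comment> \<open>\<open>h i\<close> is defined on all pairs of vectors, not only on the pairs
    that the two edges into the combination network are already known to carry.\<close>
  define h where "h i p = (K (EToS2 0) (F2 (CEs i)))\<^sup>T *\<^sub>v fst p + (K (EToS2 1) (F2 (CEs i)))\<^sup>T *\<^sub>v snd p"
    for i p
  have hV: "h i p \<in> V" if "p \<in> V \<times> V" for i p
    using that Kc by (auto simp: h_def V_def intro!: add_carrier_vec mult_mat_vec_carrier)
  have edges_N: "EToS2 0 \<in> edges N" "EToS2 1 \<in> edges N"
    "\<And>i. i < m \<Longrightarrow> F2 (CEs i) \<in> edges N"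
    "\<And>i j. i < m \<Longrightarrow> j < m \<Longrightarrow> i \<noteq> j \<Longrightarrow> F2 (CEr i j) \<in> edges N"
    by (auto simp: N_def construct_network_def comb_network_def)
  have mid: "msg (F2 (CEs i)) y = h i (msg (EToS2 0) y, msg (EToS2 1) y)" if i: "i < m" and y: "y \<in> Y" for i y
  proof (rule eq_vecI)
    let ?p = "(msg (EToS2 0) y, msg (EToS2 1) y)"
    have p: "?p \<in> V \<times> V" using msgV edges_N y by simp
    then show "dim_vec (msg (F2 (CEs i)) y) = dim_vec (h i ?p)"
      using hV[OF p, of i] msgV[OF edges_N(3)[OF i] y] by (simp add: V_def)
    fix k assume "k < dim_vec (h i ?p)"
    then have k: "k < l" using hV[OF p, of i] by (simp add: V_def)
    have "msg (F2 (CEs i)) y $ k =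
      (\<Sum>d\<in>in_edges N (V2 CSrc). ((K d (F2 (CEs i)))\<^sup>T *\<^sub>v msg d y) $ k)"
      using i y k by (intro rec)
        (auto simp: N_def construct_network_simps construct_network_out_edges comb_network_simps comb_network_out_edges)
    also have "in_edges N (V2 CSrc) = {EToS2 0, EToS2 1}"
      by (auto simp: N_def construct_network_in_edges comb_network_simps comb_network_in_edges less_2_cases_iff)
    finally show "msg (F2 (CEs i)) y $ k = h i ?p $ k"
      using k carrier_matD[OF Kc] by (simp add: h_def del: index_mult_mat_vec(1))
  qed
  have rcv: "msg (F2 (CEr i j)) y = (K (F2 (CEs i)) (F2 (CEr i j)))\<^sup>T *\<^sub>v msg (F2 (CEs i)) y"
    if ij: "i < m" "j < m" "i \<noteq> j" and y: "y \<in> Y" for i j y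
  proof (rule eq_vecI)
    have Vx: "(K (F2 (CEs i)) (F2 (CEr i j)))\<^sup>T *\<^sub>v msg (F2 (CEs i)) y \<in> V"
      by (intro KV msgV edges_N ij y)
    then show "dim_vec (msg (F2 (CEr i j)) y) = dim_vec ((K (F2 (CEs i)) (F2 (CEr i j)))\<^sup>T *\<^sub>v msg (F2 (CEs i)) y)"
      using msgV[OF edges_N(4)[OF ij] y] carrier_matD[OF Kc] by (simp add: V_def)
    fix k assume "k < dim_vec ((K (F2 (CEs i)) (F2 (CEr i j)))\<^sup>T *\<^sub>v msg (F2 (CEs i)) y)"
    then have k: "k < l" using Kc[of "F2 (CEs i)" "F2 (CEr i j)"] by simp
    have "msg (F2 (CEr i j)) y $ k =
      (\<Sum>d\<in>in_edges N (V2 (CMid i)). ((K d (F2 (CEr i j)))\<^sup>T *\<^sub>v msg d y) $ k)"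
      using ij y k by (intro rec)
        (auto simp: N_def construct_network_simps construct_network_out_edges comb_network_simps comb_network_out_edges)
    also have "in_edges N (V2 (CMid i)) = {F2 (CEs i)}"
      using ij by (auto simp: N_def construct_network_in_edges comb_network_simps comb_network_in_edges)
    finally show "msg (F2 (CEr i j)) y $ k = ((K (F2 (CEs i)) (F2 (CEr i j)))\<^sup>T *\<^sub>v msg (F2 (CEs i)) y) $ k"
      by simp
  qed
  have card_V: "card V = CARD('d) ^ l" by (simp add: V_def card_carrier_vec)
  have finV: "finite V" by (simp add: V_def)
  have surj: "\<exists>y\<in>Y. msg (F2 (CEr i j)) y = a \<and> msg (F2 (CEr j i)) y = b"
    if ij: "i < j" "j < m" and ab: "a \<in> V" "b \<in> V" for i j a b
  proof -
    define I where "I = in_edges N (V2 (CRcv i j))"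
    have IE: "I \<subseteq> edges N" unfolding I_def by (rule in_edges_subset)
    have I: "I = {F2 (CEr i j), F2 (CEr j i)} \<union> EToT (CRcv i j) ` {..<w - 2}"
      using ij by (auto simp: I_def N_def construct_network_in_edges comb_network_simps comb_network_in_edges)
    \<comment> \<open>As many incoming edges as source blocks: \<open>\<Phi>\<close> below is an
      injection between sets of equal size, hence onto.\<close>
    have "card I = 2 + (w - 2)"
      unfolding I using ij by (subst card_Un_disjoint) (auto simp: card_image inj_on_def)
    then have card_I: "card I = w" using w by simp
    have finI: "finite I" by (simp add: I)
    define \<Phi> where "\<Phi> y = restrict (\<lambda>e. msg e y) I" for y
    have inj: "inj_on \<Phi> Y"
    proof (rule inj_onI)
      fix x y assume xy: "x \<in> Y" "y \<in> Y" and eq: "\<Phi> x = \<Phi> y"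
      have "(F e)\<^sup>T *\<^sub>v (x - y) = 0\<^sub>v l" if e: "e \<in> I" for e
      proof -
        have Fe: "(F e)\<^sup>T \<in> carrier_mat l (w * l)" using Fc e IE by auto
        have "(F e)\<^sup>T *\<^sub>v (x - y) = msg e x - msg e y"
          unfolding msg_def using mult_minus_distrib_mat_vec[OF Fe] xy by (simp add: Y_def)
        also have "msg e x = msg e y" using eq e by (metis \<Phi>_def restrict_apply')
        also have "msg e y - msg e y = 0\<^sub>v l" using msgV[of e y] e IE xy by (auto simp: V_def)
        finally show ?thesis .
      qed
      then have z: "x - y = 0\<^sub>v (w * l)"
        using ij xy by (intro dec[of "V2 (CRcv i j)"])
          (auto simp: I_def Y_def N_def construct_network_simps comb_network_simps)
      show "x = y"
      proof (rule eq_vecI)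
        fix k assume "k < dim_vec y"
        then have k: "k < w * l" using xy by (simp add: Y_def)
        have "(x - y) $ k = 0" unfolding z using k by simp
        then show "x $ k = y $ k" using k xy by (simp add: Y_def)
      qed (use xy in \<open>simp add: Y_def\<close>)
    qed
    have "\<Phi> ` Y = (\<Pi>\<^sub>E e\<in>I. V)"
    proof (rule card_subset_eq)
      show "finite (\<Pi>\<^sub>E e\<in>I. V)" using finI finV by (intro finite_PiE) auto
      show "\<Phi> ` Y \<subseteq> (\<Pi>\<^sub>E e\<in>I. V)" using msgV IE by (auto simp: \<Phi>_def)
      have "card Y = CARD('d) ^ (w * l)" by (simp add: Y_def card_carrier_vec)
      then show "card (\<Phi> ` Y) = card (\<Pi>\<^sub>E e\<in>I. V)"
        by (simp add: card_image[OF inj] card_PiE finI card_I card_V power_mult[symmetric] mult.commute)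
    qed
    \<comment> \<open>The direct edges are given the value b as well; what they carry is irrelevant
      here.\<close>
    moreover have "(\<lambda>e\<in>I. if e = F2 (CEr i j) then a else b) \<in> (\<Pi>\<^sub>E e\<in>I. V)" using ab by auto
    ultimately have "(\<lambda>e\<in>I. if e = F2 (CEr i j) then a else b) \<in> \<Phi> ` Y" by (simp only:)
    then obtain y where *: "(\<lambda>e\<in>I. if e = F2 (CEr i j) then a else b) = \<Phi> y" and y: "y \<in> Y"
      by (rule imageE)
    have "msg e y = (if e = F2 (CEr i j) then a else b)" if "e \<in> I" for e
      using fun_cong[OF *, of e] that by (simp add: \<Phi>_def)
    then show ?thesis using y ij by (intro bexI[of _ y]) (auto simp: I)
  qed
  have inj: "inj_on (\<lambda>p. (h i p, h j p)) (V \<times> V)" if ij: "i < j" "j < m" for i j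
  proof -
    \<comment> \<open>\<open>\<psi>\<close> includes the last hop, since \<open>surj\<close> speaks
      of the receiver's edges. Onto a finite set of the same size, it is injective, and this passes
      to the pair \<open>h i\<close>, \<open>h j\<close> from which it is computed.\<close>
    define \<psi> where "\<psi> p = ((K (F2 (CEs i)) (F2 (CEr i j)))\<^sup>T *\<^sub>v h i p,
        (K (F2 (CEs j)) (F2 (CEr j i)))\<^sup>T *\<^sub>v h j p)" for p
    have "\<psi> ` (V \<times> V) = V \<times> V"
    proof
      show "\<psi> ` (V \<times> V) \<subseteq> V \<times> V" using KV hV by (auto simp: \<psi>_def)
      show "V \<times> V \<subseteq> \<psi> ` (V \<times> V)"
      proof
        fix ab assume "ab \<in> V \<times> V"
        then obtain a b where ab: "ab = (a, b)" "a \<in> V" "b \<in> V" by auto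
        obtain y where y: "y \<in> Y" "msg (F2 (CEr i j)) y = a" "msg (F2 (CEr j i)) y = b"
          using surj[OF ij ab(2,3)] by blast
        let ?p = "(msg (EToS2 0) y, msg (EToS2 1) y)"
        have "\<psi> ?p = (a, b)"
          using rcv[of i j y] rcv[of j i y] mid[of i y] mid[of j y] ij y by (simp add: \<psi>_def)
        moreover have "?p \<in> V \<times> V" using msgV edges_N y by simp
        ultimately show "ab \<in> \<psi> ` (V \<times> V)" using ab(1) by (metis image_eqI)
      qed
    qed
    then have "inj_on \<psi> (V \<times> V)" using finV by (intro eq_card_imp_inj_on) auto
    then show ?thesis by (auto simp: inj_on_def \<psi>_def)
  qed
  \<comment> \<open>The condition l \<ge> 1 enters here: with l = 0 there would be a single message
    and no bound on m.\<close>
  have card_d: "CARD('d) \<ge> 2" using card_mono[of "UNIV :: 'd set" "{0, 1}"] by auto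
  moreover have "CARD('d) \<le> CARD('d) ^ l" using l card_d by (intro self_le_power) auto
  ultimately have "card V \<ge> 2" by (simp add: card_V)
  then have "m \<le> card V + 1"
    using hV inj by (intro pairwise_injective_card_bound[of V "V \<times> V" m h])
      (auto simp: finV card_cartesian_product)
  then show ?thesis by (simp add: card_V)
qed

text \<open>The zero code works. The case is kept apart because the inversion in
  \<open>subnetwork_solvable\<close> relies on some receiver being able to decode.\<close>

lemma vec_lin_solvable_no_receivers:
  fixes N :: "('v, 'e) network"
  assumes fin: "finite (edges N)" and no: "receivers N = {}"
  shows "vec_lin_solvable TYPE('b::field) N l"
proof -
  let ?w = "source_dim N"
  have "finite (out_edges N (source N))" using fin out_edges_subset finite_subset by metis
  then obtain idx where idx: "bij_betw idx (out_edges N (source N)) {..<?w}"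
    using ex_bij_betw_finite_nat by (metis source_dim_def lessThan_atLeast0)
  define F :: "'e \<Rightarrow> 'b mat" where "F e = (if e \<in> out_edges N (source N)
    then mat (?w * l) l (\<lambda>(i, j). if i = idx e * l + j then 1 else 0) else 0\<^sub>m (?w * l) l)" for e
  define K :: "'e \<Rightarrow> 'e \<Rightarrow> 'b mat" where "K d e = 0\<^sub>m l l" for d e
  have F: "F e \<in> carrier_mat (?w * l) l" for e by (simp add: F_def)
  have "global_kernels N l K F"
    unfolding global_kernels_def Let_def
  proof (intro conjI ballI exI[of _ idx] idx allI impI F)
    fix v e assume "v \<in> nodes N - {source N}" "e \<in> out_edges N v"
    then have "F e = 0\<^sub>m (?w * l) l" by (auto simp: F_def out_edges_def)
    then show "F e = mat (?w * l) l (\<lambda>(i, j). \<Sum>d\<in>in_edges N v. (F d * K d e) $$ (i, j))"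
      unfolding K_def right_mult_zero_mat[OF F] by (intro eq_matI) auto
  qed (simp add: F_def)
  moreover have "vec_lin_code N l K" by (simp add: vec_lin_code_def K_def)
  ultimately show ?thesis
    unfolding vec_lin_solvable_def vec_lin_solution_def using no by blast
qed

text \<open>A source message that is silent on all edges leaving the source of \<open>N1\<close> is
  silent throughout \<open>N1\<close>, so a receiver there forces it to be 0. The square matrix
  \<open>C\<close> of these edges' kernels is thus invertible, and its inverse restores the identity
  at the source.\<close>

lemma subnetwork_solvable:
  assumes net: "multicast_network N1" and w1: "source_dim N1 \<ge> 1"
    and fin2: "finite (edges N2)" "finite (receivers N2)"
    and sol: "vec_lin_solvable TYPE('b::field) (construct_network N1 N2 (source_dim N1)) l"
  shows "vec_lin_solvable TYPE('b) N1 l"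
proof (cases "receivers N1 = {}")
  case True
  then show ?thesis using net vec_lin_solvable_no_receivers by (auto simp: multicast_network_def)
next
  case False
  define w where "w = source_dim N1"
  define N where "N = construct_network N1 N2 w"
  have fin1: "finite (edges N1)" using net by (simp add: multicast_network_def)
  have sd: "source_dim N = w" unfolding N_def by (rule source_dim_construct_network)
  have finN: "finite (edges N)"
    unfolding N_def by (intro finite_edges_construct_network fin1 fin2)
  obtain K and F :: "_ \<Rightarrow> 'b mat" where "vec_lin_solution N l K F"
    using sol by (auto simp: vec_lin_solvable_def N_def w_def)
  then have code: "vec_lin_code N l K" and gk: "global_kernels N l K F"
    and dec: "\<And>t y. t \<in> receivers N \<Longrightarrow> y \<in> carrier_vec (w * l) \<Longrightarrow>
      (\<forall>e\<in>in_edges N t. (F e)\<^sup>T *\<^sub>v y = 0\<^sub>v l) \<Longrightarrow> y = 0\<^sub>v (w * l)"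
    by (simp_all add: vec_lin_solution_iff[OF finN] sd)
  have Kc: "K d e \<in> carrier_mat l l" for d e using code by (simp add: vec_lin_code_def)
  have Fc: "F (F1 e) \<in> carrier_mat (w * l) l" if "e \<in> edges N1" for e
  proof -
    have "F1 e \<in> edges N" using that by (simp add: N_def construct_network_edges)
    then show ?thesis using gk by (simp add: global_kernels_def Let_def sd)
  qed
  let ?s = "source N1"
  have tail: "etail N1 e \<in> nodes N1" if "e \<in> edges N1" for e
    using net that by (simp add: multicast_network_def)
  have in_s: "in_edges N1 ?s = {}" using net by (simp add: multicast_network_def)
  \<comment> \<open>In the large network the source of \<open>N1\<close> is fed by the edges
    \<open>EToS1\<close>, so a receiver located there would see messages from outside
    \<open>N1\<close>. Dimension at least 1 gives it a path, whose last edge cannot enter the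
    source.\<close>
  have rcv_s: "t \<noteq> ?s" if "t \<in> receivers N1" for t
  proof
    assume "t = ?s"
    have "\<forall>t\<in>receivers N1. \<exists>P. length P = source_dim N1 \<and>
        (\<forall>p\<in>set P. is_path N1 p ?s t) \<and> distinct (concat P)"
      using net by (simp add: multicast_network_def)
    from bspec[OF this that] obtain P where P: "length P = source_dim N1"
      "\<forall>p\<in>set P. is_path N1 p ?s t" by (elim exE conjE)
    then have "is_path N1 (hd P) ?s t" using w1 by (cases P) simp_all
    then have "last (hd P) \<in> in_edges N1 t" by (auto simp: is_path_def in_edges_def)
    then show False using in_s \<open>t = ?s\<close> by simp
  qed
  have in_V1: "in_edges N (V1 v) = F1 ` in_edges N1 v" if "v \<noteq> ?s" for v
    using that by (simp add: N_def construct_network_in_edges)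
  \<comment> \<open>Everything sent inside the subnetwork is determined by what leaves its source.\<close>
  have vanish: "(F (F1 e))\<^sup>T *\<^sub>v y = 0\<^sub>v l"
    if y: "y \<in> carrier_vec (w * l)" and e: "e \<in> edges N1"
      and s0: "\<And>e. e \<in> out_edges N1 ?s \<Longrightarrow> (F (F1 e))\<^sup>T *\<^sub>v y = 0\<^sub>v l" for y e
  proof -
    define R where "R = {(etail N1 e, ehead N1 e) | e. e \<in> edges N1}"
    have "R = (\<lambda>e. (etail N1 e, ehead N1 e)) ` edges N1" by (auto simp: R_def)
    then have "finite R" using fin1 by simp
    moreover have "acyclic R" using net by (simp add: multicast_network_def R_def)
    ultimately have "wf R" by (rule finite_acyclic_wf)
    then have "\<forall>e\<in>out_edges N1 v. (F (F1 e))\<^sup>T *\<^sub>v y = 0\<^sub>v l" for v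
    proof (induction v rule: wf_induct_rule)
      case (less v)
      show ?case
      proof (cases "v = ?s")
        case True
        then show ?thesis using s0 by blast
      next
        case False
        show ?thesis
        proof
          fix e assume e: "e \<in> out_edges N1 v"
          then have eE: "e \<in> edges N1" and v: "v \<in> nodes N1"
            using tail by (auto simp: out_edges_def)
          show "(F (F1 e))\<^sup>T *\<^sub>v y = 0\<^sub>v l"
          proof (rule eq_vecI)
            fix k assume "k < dim_vec (0\<^sub>v l :: 'b vec)"
            then have k: "k < l" by simp
            have "((F (F1 e))\<^sup>T *\<^sub>v y) $ k =
              (\<Sum>d\<in>in_edges N (V1 v). ((K d (F1 e))\<^sup>T *\<^sub>v ((F d)\<^sup>T *\<^sub>v y)) $ k)"
              using v e y k by (intro message_recursion[OF finN code gk])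
                (auto simp: N_def source_dim_construct_network construct_network_simps construct_network_out_edges)
            also have "\<dots> = 0"
            proof (rule sum.neutral, rule ballI)
              fix d assume "d \<in> in_edges N (V1 v)"
              then obtain d' where d': "d = F1 d'" "d' \<in> in_edges N1 v" using in_V1[OF False] by auto
              then have "(etail N1 d', v) \<in> R" "d' \<in> out_edges N1 (etail N1 d')"
                by (auto simp: R_def in_edges_def out_edges_def)
              then have "(F d)\<^sup>T *\<^sub>v y = 0\<^sub>v l" using less.IH d'(1) by blast
              then show "((K d (F1 e))\<^sup>T *\<^sub>v ((F d)\<^sup>T *\<^sub>v y)) $ k = 0"
                using k Kc[of d "F1 e"] by (simp add: scalar_prod_def)
            qed
            finally show "((F (F1 e))\<^sup>T *\<^sub>v y) $ k = 0\<^sub>v l $ k" using k by simp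
          qed (use Fc[OF eE] in simp)
        qed
      qed
    qed
    then show ?thesis using e by (auto simp: out_edges_def)
  qed
  have "finite (out_edges N1 ?s)" using fin1 out_edges_subset finite_subset by metis
  then obtain idx where idx: "bij_betw idx (out_edges N1 ?s) {..<w}"
    using ex_bij_betw_finite_nat by (metis source_dim_def lessThan_atLeast0 w_def)
  define g where "g = inv_into (out_edges N1 ?s) idx"
  have g: "g k \<in> out_edges N1 ?s" if "k < w" for k
    using idx that unfolding g_def by (metis bij_betw_imp_surj_on inv_into_into lessThan_iff)
  have g_idx: "g (idx e) = e" if "e \<in> out_edges N1 ?s" for e
    using idx that by (simp add: g_def bij_betw_inv_into_left)
  \<comment> \<open>The k-th block of l columns is the kernel of the k-th edge leaving the source of
    \<open>N1\<close>, so \<open>C\<^sup>T *\<^sub>v y\<close> lists all messages sent on these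
    edges.\<close>
  define C where "C = mat (w * l) (w * l) (\<lambda>(i, k). F (F1 (g (k div l))) $$ (i, k mod l))"
  have C: "C \<in> carrier_mat (w * l) (w * l)" by (simp add: C_def)
  have pos: "k * l + j < w * l" if "k < w" "j < l" for k j
  proof -
    have "k * l + j < Suc k * l" using that(2) by simp
    also have "\<dots> \<le> w * l" using that(1) by (intro mult_le_mono1) simp
    finally show ?thesis .
  qed
  have C_col: "C $$ (i, idx e * l + j) = F (F1 e) $$ (i, j)"
    if "e \<in> out_edges N1 ?s" "i < w * l" "j < l" for e i j
  proof -
    have "idx e < w" using idx that(1) by (auto simp: bij_betw_def)
    then show ?thesis using that pos[of "idx e" j] by (simp add: C_def g_idx)
  qed
  have "y = 0\<^sub>v (w * l)" if y: "y \<in> carrier_vec (w * l)" and z: "C\<^sup>T *\<^sub>v y = 0\<^sub>v (w * l)" for y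
  proof -
    have "(F (F1 e))\<^sup>T *\<^sub>v y = 0\<^sub>v l" if e: "e \<in> out_edges N1 ?s" for e
    proof (rule eq_vecI)
      have Fe: "F (F1 e) \<in> carrier_mat (w * l) l" by (rule Fc[OF subsetD[OF out_edges_subset e]])
      then show "dim_vec ((F (F1 e))\<^sup>T *\<^sub>v y) = dim_vec (0\<^sub>v l :: 'b vec)" by simp
      fix j assume "j < dim_vec (0\<^sub>v l :: 'b vec)"
      then have j: "j < l" by simp
      have "idx e < w" using idx e by (auto simp: bij_betw_def)
      then have p: "idx e * l + j < w * l" using pos j by blast
      have "((F (F1 e))\<^sup>T *\<^sub>v y) $ j = (\<Sum>i<w * l. C $$ (i, idx e * l + j) * y $ i)"
        by (simp only: transpose_mult_vec_index[OF Fe y j])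
          (rule sum.cong[OF refl], simp add: C_col[OF e _ j])
      also have "\<dots> = (C\<^sup>T *\<^sub>v y) $ (idx e * l + j)"
        by (rule transpose_mult_vec_index[OF C y p, symmetric])
      also have "\<dots> = 0" using z p by simp
      finally show "((F (F1 e))\<^sup>T *\<^sub>v y) $ j = 0\<^sub>v l $ j" using j by simp
    qed
    then have all0: "(F (F1 e))\<^sup>T *\<^sub>v y = 0\<^sub>v l" if "e \<in> edges N1" for e
      using vanish[OF y that] by blast
    obtain t where t: "t \<in> receivers N1" using False by blast
    show ?thesis
    proof (rule dec[OF _ y])
      show "V1 t \<in> receivers N" using t by (simp add: N_def construct_network_simps)
      show "\<forall>e\<in>in_edges N (V1 t). (F e)\<^sup>T *\<^sub>v y = 0\<^sub>v l"
        using all0 in_edges_subset[of N1 t] by (auto simp: in_V1[OF rcv_s[OF t]])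
    qed
  qed
  then have "det (C\<^sup>T) \<noteq> 0" using det_0_iff_vec_prod_zero_field[of "C\<^sup>T" "w * l"] C by auto
  then have "det C \<noteq> 0" by (simp add: det_transpose[OF C])
  then obtain D where D: "D \<in> carrier_mat (w * l) (w * l)" "D * C = 1\<^sub>m (w * l)"
    using det_non_zero_imp_unit[OF C, of "()"] by (auto simp: Units_def ring_mat_def)
  \<comment> \<open>The local kernels are merely restricted; only the source coordinates of the
    global ones change.\<close>
  define K' F' where "K' d e = K (F1 d) (F1 e)" and "F' e = D * F (F1 e)" for d e
  have "vec_lin_code N1 l K'"
    unfolding vec_lin_code_def
  proof (intro conjI allI impI)
    show "K' d e \<in> carrier_mat l l" for d e using Kc by (simp add: K'_def)
    fix d e assume not: "\<not> (\<exists>v. d \<in> in_edges N1 v \<and> e \<in> out_edges N1 v)"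
    have "\<not> (\<exists>v. F1 d \<in> in_edges N v \<and> F1 e \<in> out_edges N v)"
      using not by (auto simp: N_def in_edges_def out_edges_def construct_network_edges construct_network_ends)
    then show "K' d e = 0\<^sub>m l l" using code by (simp add: vec_lin_code_def K'_def)
  qed
  moreover have "global_kernels N1 l K' F'"
    unfolding global_kernels_def Let_def w_def[symmetric]
  proof (intro conjI ballI exI[of _ idx] idx allI impI)
    show "F' e \<in> carrier_mat (w * l) l" if "e \<in> edges N1" for e
      using D(1) Fc[OF that] by (simp add: F'_def)
    show "F' e $$ (i, j) = (if i = idx e * l + j then 1 else 0)"
      if e: "e \<in> out_edges N1 ?s" and i: "i < w * l" and j: "j < l" for e i j
    proof -
      have Fe: "F (F1 e) \<in> carrier_mat (w * l) l" by (rule Fc[OF subsetD[OF out_edges_subset e]])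
      have "idx e < w" using idx e by (auto simp: bij_betw_def)
      then have p: "idx e * l + j < w * l" using pos j by blast
      have "col (F (F1 e)) j = col C (idx e * l + j)"
        using Fe C j p by (intro eq_vecI) (auto simp: C_col[OF e _ j])
      then have "F' e $$ (i, j) = (D * C) $$ (i, idx e * l + j)"
        using D(1) Fe C i j p by (simp add: F'_def)
      then show ?thesis using D(2) i p by simp
    qed
    fix v e assume v: "v \<in> nodes N1 - {?s}" and e: "e \<in> out_edges N1 v"
    have "F (F1 e) = mat (w * l) l (\<lambda>(i, j). \<Sum>d\<in>in_edges N (V1 v). (F d * K d (F1 e)) $$ (i, j))"
      using gk v e unfolding global_kernels_def Let_def sd
      by (auto simp: N_def construct_network_simps construct_network_out_edges)
    also have "\<dots> = mat (w * l) l (\<lambda>(i, j). \<Sum>d\<in>in_edges N1 v. (F (F1 d) * K' d e) $$ (i, j))"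
      using v by (simp add: in_V1 sum.reindex inj_on_def K'_def)
    finally have "F' e = D * mat (w * l) l (\<lambda>(i, j). \<Sum>d\<in>in_edges N1 v. (F (F1 d) * K' d e) $$ (i, j))"
      by (simp add: F'_def)
    also have "\<dots> = mat (w * l) l (\<lambda>(i, j). \<Sum>d\<in>in_edges N1 v. (F' d * K' d e) $$ (i, j))"
      unfolding F'_def
      using Fc in_edges_subset[of N1 v] Kc by (intro mult_mat_kernel_sum[OF D(1)]) (auto simp: K'_def)
    finally show "F' e = mat (w * l) l (\<lambda>(i, j). \<Sum>d\<in>in_edges N1 v. (F' d * K' d e) $$ (i, j))" .
  qed
  moreover have "y = 0\<^sub>v (w * l)" if t: "t \<in> receivers N1" and y: "y \<in> carrier_vec (w * l)"
    and z: "\<forall>e\<in>in_edges N1 t. (F' e)\<^sup>T *\<^sub>v y = 0\<^sub>v l" for t y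
  proof -
    \<comment> \<open>\<open>D\<^sup>T *\<^sub>v y\<close> is the message of the large network that
      makes the source of \<open>N1\<close> send y. It is decodable there, and applying
      \<open>C\<^sup>T\<close> gives y back.\<close>
    have Dy: "D\<^sup>T *\<^sub>v y \<in> carrier_vec (w * l)" using D(1) y by simp
    have "(F (F1 e))\<^sup>T *\<^sub>v (D\<^sup>T *\<^sub>v y) = 0\<^sub>v l" if e: "e \<in> in_edges N1 t" for e
    proof -
      have Fe: "F (F1 e) \<in> carrier_mat (w * l) l" by (rule Fc[OF subsetD[OF in_edges_subset e]])
      have "(F (F1 e))\<^sup>T *\<^sub>v (D\<^sup>T *\<^sub>v y) = (F' e)\<^sup>T *\<^sub>v y"
        unfolding F'_def transpose_mult[OF D(1) Fe]
        by (rule assoc_mult_mat_vec[symmetric, of _ l "w * l" _ "w * l"]) (use Fe D(1) y in auto)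
      then show ?thesis using z e by simp
    qed
    then have "D\<^sup>T *\<^sub>v y = 0\<^sub>v (w * l)"
      using t by (intro dec[OF _ Dy, of "V1 t"])
        (auto simp: in_V1[OF rcv_s[OF t]], simp add: N_def construct_network_simps)
    then have "C\<^sup>T *\<^sub>v (D\<^sup>T *\<^sub>v y) = 0\<^sub>v (w * l)" using C by (intro eq_vecI) (auto simp: scalar_prod_def)
    moreover have "C\<^sup>T *\<^sub>v (D\<^sup>T *\<^sub>v y) = (D * C)\<^sup>T *\<^sub>v y"
      unfolding transpose_mult[OF D(1) C]
      by (rule assoc_mult_mat_vec[symmetric, of _ "w * l" "w * l" _ "w * l"]) (use C D(1) y in auto)
    ultimately show "y = 0\<^sub>v (w * l)" using y by (simp add: D(2))
  qed
  ultimately show ?thesis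
    unfolding vec_lin_solvable_def vec_lin_solution_iff[OF fin1] w_def[symmetric] by blast
qed

section \<open>A vector solution of the combined network\<close>

lemma mult_delta_mat:
  fixes A :: "'a::field mat"
  assumes "A \<in> carrier_mat r l" "i < r" "j < l"
  shows "(A * (if P then 1\<^sub>m l else 0\<^sub>m l l)) $$ (i, j) = (if P then A $$ (i, j) else 0)"
  using assms right_mult_one_mat[OF assms(1)] right_mult_zero_mat[OF assms(1)] by simp

text \<open>Node \<open>NS\<close> forwards source blocks unchanged, \<open>N1\<close> runs its own
  code on them, and middle node i sends \<open>A i *\<^sub>v u 0 + B i *\<^sub>v u 1\<close>. Two
  such combinations determine the first two blocks; the direct edges deliver the others.\<close>

lemma construct_network_solvable:
  fixes N1 :: "('v, 'e) network" and A B :: "nat \<Rightarrow> 'a::field mat"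
  assumes net: "multicast_network N1" and w2: "source_dim N1 \<ge> 2"
    and sol: "vec_lin_solvable TYPE('a) N1 l"
    and A: "\<And>i. A i \<in> carrier_mat l l" and B: "\<And>i. B i \<in> carrier_mat l l"
    and spread: "\<And>i j u v. i < j \<Longrightarrow> j < m \<Longrightarrow> u \<in> carrier_vec l \<Longrightarrow> v \<in> carrier_vec l \<Longrightarrow>
      A i *\<^sub>v u + B i *\<^sub>v v = 0\<^sub>v l \<Longrightarrow> A j *\<^sub>v u + B j *\<^sub>v v = 0\<^sub>v l \<Longrightarrow> u = 0\<^sub>v l \<and> v = 0\<^sub>v l"
  shows "vec_lin_solvable TYPE('a) (construct_network N1 (comb_network m) (source_dim N1)) l"
proof -
  define w where "w = source_dim N1"
  define N where "N = construct_network N1 (comb_network m) w"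
  have sd: "source_dim N = w" unfolding N_def by (rule source_dim_construct_network)
  have fin1: "finite (edges N1)" using net by (simp add: multicast_network_def)
  have finN: "finite (edges N)"
    unfolding N_def by (intro finite_edges_construct_network fin1 finite_comb_network)
  have in_s: "in_edges N1 (source N1) = {}" using net by (simp add: multicast_network_def)
  obtain K1 and G1 :: "'e \<Rightarrow> 'a mat" where "vec_lin_solution N1 l K1 G1"
    using sol by (auto simp: vec_lin_solvable_def)
  then have code1: "vec_lin_code N1 l K1" and gk1: "global_kernels N1 l K1 G1"
    and dec1: "\<And>t y. t \<in> receivers N1 \<Longrightarrow> y \<in> carrier_vec (w * l) \<Longrightarrow>
      (\<forall>e\<in>in_edges N1 t. (G1 e)\<^sup>T *\<^sub>v y = 0\<^sub>v l) \<Longrightarrow> y = 0\<^sub>v (w * l)"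
    by (simp_all add: vec_lin_solution_iff[OF fin1] w_def)
  have K1: "K1 d e \<in> carrier_mat l l" for d e using code1 by (simp add: vec_lin_code_def)
  have G1: "G1 e \<in> carrier_mat (w * l) l" if "e \<in> edges N1" for e
    using gk1 that by (simp add: global_kernels_def Let_def w_def)
  obtain idx where idx: "bij_betw idx (out_edges N1 (source N1)) {..<w}"
    and G1_source: "\<And>e i j. e \<in> out_edges N1 (source N1) \<Longrightarrow> i < w * l \<Longrightarrow> j < l \<Longrightarrow>
      G1 e $$ (i, j) = (if i = idx e * l + j then 1 else 0)"
    using gk1 by (auto simp: global_kernels_def Let_def w_def)
  \<comment> \<open>The k-th block column of the identity: an edge with this kernel carries block k
    of the source message.\<close>
  define blk :: "nat \<Rightarrow> 'a mat" where
    "blk k = mat (w * l) l (\<lambda>(i, j). if i = k * l + j then 1 else 0)" for k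
  have blk: "blk k \<in> carrier_mat (w * l) l" for k by (simp add: blk_def)
  define M where "M i = blk 0 * (A i)\<^sup>T + blk 1 * (B i)\<^sup>T" for i
  have M: "M i \<in> carrier_mat (w * l) l" for i
    using A[of i] B[of i] unfolding M_def by (intro add_carrier_mat mult_carrier_mat[OF blk]) auto
  \<comment> \<open>The direct edges start at block 2, since blocks 0 and 1 reach the receiver
    through the combination network.\<close>
  define F where "F e = (case e of ETop k \<Rightarrow> blk k | EToS1 k \<Rightarrow> blk k | EToS2 k \<Rightarrow> blk k
    | EToT t k \<Rightarrow> blk (k + 2) | F1 d \<Rightarrow> G1 d | F2 d \<Rightarrow> (case d of CEs i \<Rightarrow> M i | CEr i j \<Rightarrow> M i))"
    for e :: "('e, comb_edge, comb_node) cedge"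
  define \<delta> :: "bool \<Rightarrow> 'a mat" where "\<delta> P = (if P then 1\<^sub>m l else 0\<^sub>m l l)" for P
  have \<delta>: "\<delta> P \<in> carrier_mat l l" for P by (simp add: \<delta>_def)
  \<comment> \<open>\<open>idx\<close> is the numbering of the edges leaving the source of
    \<open>N1\<close> that its own kernels come with; the forwarding has to follow it. Values on
    nonadjacent pairs may be arbitrary, as \<open>K\<close> cuts them off.\<close>
  define K0 where "K0 d e = (case d of
      ETop i \<Rightarrow> (case e of EToS1 k \<Rightarrow> \<delta> (i = k) | EToS2 k \<Rightarrow> \<delta> (i = k) | EToT t k \<Rightarrow> \<delta> (i = k + 2)
        | _ \<Rightarrow> \<delta> False)
    | EToS1 k \<Rightarrow> (case e of F1 e' \<Rightarrow> \<delta> (k = idx e') | _ \<Rightarrow> \<delta> False)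
    | EToS2 k \<Rightarrow> (case e of F2 e' \<Rightarrow> (case e' of CEs i \<Rightarrow> (if k = 0 then (A i)\<^sup>T else (B i)\<^sup>T) | _ \<Rightarrow> \<delta> False)
        | _ \<Rightarrow> \<delta> False)
    | F1 d' \<Rightarrow> (case e of F1 e' \<Rightarrow> K1 d' e' | _ \<Rightarrow> \<delta> False)
    | F2 d' \<Rightarrow> \<delta> True
    | EToT t k \<Rightarrow> \<delta> False)"
    for d e :: "('e, comb_edge, comb_node) cedge"
  have K0: "K0 d e \<in> carrier_mat l l" for d e
    using A B K1 \<delta> by (simp add: K0_def split: cedge.splits comb_edge.splits)
  define K where "K d e = (if \<exists>v. d \<in> in_edges N v \<and> e \<in> out_edges N v then K0 d e else 0\<^sub>m l l)" for d e
  have K_K0: "K d e = K0 d e" if "d \<in> in_edges N v" "e \<in> out_edges N v" for d e v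
    using that by (auto simp: K_def)
  have code: "vec_lin_code N l K"
    unfolding vec_lin_code_def
  proof (intro conjI allI impI)
    show "K d e \<in> carrier_mat l l" for d e using K0 by (simp add: K_def)
    show "K d e = 0\<^sub>m l l" if "\<not> (\<exists>v. d \<in> in_edges N v \<and> e \<in> out_edges N v)" for d e
      using that by (simp only: K_def if_False)
  qed
  have F_simps: "F (ETop k) = blk k" "F (EToS1 k) = blk k" "F (EToS2 k) = blk k"
    "F (EToT t k) = blk (k + 2)" "F (F1 d) = G1 d" "F (F2 (CEs i)) = M i" "F (F2 (CEr i j)) = M i"
    for k t d i j by (simp_all add: F_def)
  have Fc: "F e \<in> carrier_mat (w * l) l" if "e \<in> edges N" for e
    using that blk M G1
    by (cases e) (auto simp: F_def N_def construct_network_edges split: comb_edge.splits)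
  have select: "(\<Sum>k<w. (blk k * \<delta> (k = n)) $$ (i, j)) = blk n $$ (i, j)"
    if "n < w" "i < w * l" "j < l" for n i j
    using that by (simp add: \<delta>_def mult_delta_mat[OF blk] sum.delta del: index_mult_mat(1))
  have gk: "global_kernels N l K F"
    unfolding global_kernels_def Let_def sd
  proof (intro conjI ballI Fc)
    show "\<exists>idx. bij_betw idx (out_edges N (source N)) {..<w} \<and>
        (\<forall>e\<in>out_edges N (source N). \<forall>i<w * l. \<forall>j<l. F e $$ (i, j) = (if i = idx e * l + j then 1 else 0))"
    proof (intro exI conjI)
      let ?idx = "\<lambda>e :: ('e, comb_edge, comb_node) cedge. case e of ETop k \<Rightarrow> k | _ \<Rightarrow> 0"
      show "bij_betw ?idx (out_edges N (source N)) {..<w}"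
        by (auto simp: bij_betw_def inj_on_def N_def construct_network_simps construct_network_out_edges image_image)
      show "\<forall>e\<in>out_edges N (source N). \<forall>i<w * l. \<forall>j<l. F e $$ (i, j) = (if i = ?idx e * l + j then 1 else 0)"
        by (auto simp: N_def construct_network_simps construct_network_out_edges F_simps blk_def)
    qed
    fix v e assume v: "v \<in> nodes N - {source N}" and e: "e \<in> out_edges N v"
    have sum0: "F e $$ (i, j) = (\<Sum>d\<in>in_edges N v. (F d * K0 d e) $$ (i, j))" if i: "i < w * l" and j: "j < l" for i j
    proof -
      consider "v = NS" | "v = V1 (source N1)" | v1 where "v = V1 v1" "v1 \<in> nodes N1" "v1 \<noteq> source N1"
        | "v = V2 CSrc" | n where "v = V2 (CMid n)" "n < m" | a b where "v = V2 (CRcv a b)"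
        using v by (auto simp: N_def construct_network_simps comb_network_simps)
      then show ?thesis
      proof cases
        case 1
        have inv: "in_edges N v = ETop ` {..<w}" by (simp add: 1 N_def construct_network_in_edges)
        have "e \<in> EToS1 ` {..<w} \<union> EToS2 ` {..<2} \<union> {EToT t i | t i. t \<in> receivers (comb_network m) \<and> i < w - 2}"
          using e by (simp add: 1 N_def construct_network_out_edges)
        then show ?thesis
          using w2 i j
          by (auto simp: inv sum.reindex inj_on_def F_simps K0_def select w_def[symmetric] simp del: index_mult_mat(1))
      next
        case 2
        have inv: "in_edges N v = EToS1 ` {..<w}" by (simp add: 2 N_def construct_network_in_edges in_s)
        obtain d where d: "e = F1 d" "d \<in> out_edges N1 (source N1)"
          using e by (auto simp: 2 N_def construct_network_out_edges)
        have "idx d < w" using idx d(2) by (auto simp: bij_betw_def)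
        then show ?thesis using i j
          by (simp add: inv sum.reindex inj_on_def F_simps d(1) K0_def select G1_source[OF d(2)] del: index_mult_mat(1))
            (simp add: blk_def)
      next
        case 3
        have inv: "in_edges N v = F1 ` in_edges N1 v1" by (simp add: 3 N_def construct_network_in_edges)
        obtain d where d: "e = F1 d" "d \<in> out_edges N1 v1"
          using e by (auto simp: 3 N_def construct_network_out_edges)
        have "G1 d = mat (w * l) l (\<lambda>(i, j). \<Sum>c\<in>in_edges N1 v1. (G1 c * K1 c d) $$ (i, j))"
          using gk1 3 d(2) by (simp add: global_kernels_def Let_def w_def)
        then show ?thesis using i j
          by (simp add: inv sum.reindex inj_on_def F_simps d(1) K0_def del: index_mult_mat(1))
      next
        case 4
        have inv: "in_edges N v = {EToS2 0, EToS2 1}"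
          by (auto simp: 4 N_def construct_network_in_edges comb_network_simps comb_network_in_edges less_2_cases_iff)
        obtain n where "e = F2 (CEs n)"
          using e by (auto simp: 4 N_def construct_network_out_edges comb_network_out_edges)
        then show ?thesis
          using i j carrier_matD[OF blk] carrier_matD[OF B]
          by (simp add: inv F_simps K0_def M_def del: index_mult_mat(1))
      next
        case 5
        have inv: "in_edges N v = {F2 (CEs n)}"
          using 5 by (auto simp: N_def construct_network_in_edges comb_network_simps comb_network_in_edges)
        obtain b where "e = F2 (CEr n b)"
          using e by (auto simp: 5 N_def construct_network_out_edges comb_network_out_edges)
        then show ?thesis
          using right_mult_one_mat[OF M] by (simp add: inv F_simps K0_def \<delta>_def del: index_mult_mat(1))
      next
        case 6
        then show ?thesis using e by (simp add: N_def construct_network_out_edges comb_network_out_edges)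
      qed
    qed
    have "(\<Sum>d\<in>in_edges N v. (F d * K d e) $$ (i, j)) = (\<Sum>d\<in>in_edges N v. (F d * K0 d e) $$ (i, j))" for i j
      by (rule sum.cong[OF refl]) (simp only: K_K0[OF _ e])
    then show "F e = mat (w * l) l (\<lambda>(i, j). \<Sum>d\<in>in_edges N v. (F d * K d e) $$ (i, j))"
      using Fc[OF subsetD[OF out_edges_subset e]] by (intro eq_matI) (simp_all add: sum0 del: index_mult_mat(1))
  qed
  have "y = 0\<^sub>v (w * l)" if t: "t \<in> receivers N" and y: "y \<in> carrier_vec (w * l)"
    and z: "\<forall>e\<in>in_edges N t. (F e)\<^sup>T *\<^sub>v y = 0\<^sub>v l" for t y
  proof -
    consider t1 where "t = V1 t1" "t1 \<in> receivers N1" | a b where "t = V2 (CRcv a b)" "a < b" "b < m"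
      using t by (auto simp: N_def construct_network_simps comb_network_simps)
    then show ?thesis
    proof cases
      case 1
      then have "(G1 e)\<^sup>T *\<^sub>v y = 0\<^sub>v l" if "e \<in> in_edges N1 t1" for e
        using z that by (auto simp: N_def construct_network_in_edges F_simps dest!: bspec[of _ _ "F1 e"])
      then show ?thesis using dec1 1(2) y by blast
    next
      case 2
      define u where "u k = (blk k)\<^sup>T *\<^sub>v y" for k
      have u: "u k \<in> carrier_vec l" for k
        unfolding u_def using blk[of k] y by (intro mult_mat_vec_carrier[of _ l "w * l"]) auto
      have intv: "in_edges N t = {F2 (CEr a b), F2 (CEr b a)} \<union> EToT (CRcv a b) ` {..<w - 2}"
        using 2 by (auto simp: N_def construct_network_in_edges comb_network_simps comb_network_in_edges)
      have My: "(M i)\<^sup>T *\<^sub>v y = A i *\<^sub>v u 0 + B i *\<^sub>v u 1" for i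
      proof -
        have "(M i)\<^sup>T = A i * (blk 0)\<^sup>T + B i * (blk 1)\<^sup>T"
        proof -
          have *: "(blk c * X\<^sup>T)\<^sup>T = X * (blk c)\<^sup>T" if "X \<in> carrier_mat l l" for X c
            using transpose_mult[OF blk, of "X\<^sup>T" l c] that by simp
          have "blk c * X\<^sup>T \<in> carrier_mat (w * l) l" if "X \<in> carrier_mat l l" for X c
            using that by (intro mult_carrier_mat[OF blk]) simp
          from transpose_add[OF this[OF A] this[OF B]] show ?thesis
            unfolding M_def by (simp add: *[OF A] *[OF B])
        qed
        moreover have "(A i * (blk 0)\<^sup>T + B i * (blk 1)\<^sup>T) *\<^sub>v y =
            (A i * (blk 0)\<^sup>T) *\<^sub>v y + (B i * (blk 1)\<^sup>T) *\<^sub>v y"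
          by (rule add_mult_distrib_mat_vec[of _ l "w * l"]) (use blk A[of i] B[of i] y in auto)
        moreover have "(A i * (blk 0)\<^sup>T) *\<^sub>v y = A i *\<^sub>v u 0" "(B i * (blk 1)\<^sup>T) *\<^sub>v y = B i *\<^sub>v u 1"
          unfolding u_def using blk A[of i] B[of i] y
          by (auto intro!: assoc_mult_mat_vec[of _ l l _ "w * l"])
        ultimately show ?thesis by simp
      qed
      have "A a *\<^sub>v u 0 + B a *\<^sub>v u 1 = 0\<^sub>v l" "A b *\<^sub>v u 0 + B b *\<^sub>v u 1 = 0\<^sub>v l"
        unfolding My[symmetric] using z by (simp_all add: intv F_simps)
      then have u01: "u 0 = 0\<^sub>v l" "u 1 = 0\<^sub>v l" using spread[OF 2(2,3) u u] by blast+
      have uk: "u k = 0\<^sub>v l" if "k < w" for k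
      proof (cases "k < 2")
        case True
        then show ?thesis using u01 by (auto simp: less_2_cases_iff)
      next
        case False
        then have "EToT (CRcv a b) (k - 2) \<in> in_edges N t" using that by (simp add: intv)
        then have "(F (EToT (CRcv a b) (k - 2)))\<^sup>T *\<^sub>v y = 0\<^sub>v l" using z by blast
        moreover have "k - 2 + 2 = k" using False by simp
        ultimately show ?thesis unfolding F_simps u_def by simp
      qed
      show ?thesis
      proof (rule eq_vecI)
        fix i assume "i < dim_vec (0\<^sub>v (w * l) :: 'a vec)"
        then have i: "i < w * l" by simp
        then have l: "l > 0" by (cases l) auto
        \<comment> \<open>Entry i of y is entry \<open>i mod l\<close> of block
          \<open>i div l\<close>, so y vanishes once all blocks do.\<close>
        have k: "i div l < w" and j: "i mod l < l" using i l by (simp_all add: less_mult_imp_div_less)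
        have "u (i div l) $ (i mod l) = (\<Sum>c<w * l. blk (i div l) $$ (c, i mod l) * y $ c)"
          unfolding u_def by (rule transpose_mult_vec_index[OF blk y j])
        also have "\<dots> = (\<Sum>c<w * l. if c = i then y $ c else 0)"
          using j by (intro sum.cong) (auto simp: blk_def)
        also have "\<dots> = y $ i" using i by simp
        finally show "y $ i = 0\<^sub>v (w * l) $ i" using uk[OF k] i j by simp
      qed (use y in simp)
    qed
  qed
  then have "vec_lin_solution N l K F"
    using code gk by (simp add: vec_lin_solution_iff[OF finN] sd)
  then show ?thesis by (auto simp: vec_lin_solvable_def N_def w_def)
qed

theorem theorem4:
  fixes N1 :: "('v, 'e) network" and L :: nat
  assumes "multicast_network N1"
    and "source_dim N1 \<ge> 2"
    and "L \<ge> 1"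
    and "CARD('c::{field,finite}) = CARD('a::{field,finite}) ^ L"
    and "vec_lin_solvable TYPE('a) N1 L"
    and "\<not> vec_lin_solvable TYPE('c) N1 1"
  shows "vec_lin_solvable TYPE('a)
           (construct_network N1 (comb_network (CARD('a) ^ L + 1)) (source_dim N1)) L
       \<and> (CARD('b::{field,finite}) \<le> CARD('a) ^ L \<longrightarrow>
           \<not> vec_lin_solvable TYPE('b)
              (construct_network N1 (comb_network (CARD('a) ^ L + 1)) (source_dim N1)) 1)
       \<and> (\<forall>L'\<ge>1. CARD('d::{field,finite}) ^ L' < CARD('a) ^ L \<longrightarrow>
           \<not> vec_lin_solvable TYPE('d)
              (construct_network N1 (comb_network (CARD('a) ^ L + 1)) (source_dim N1)) L')"
proof (intro conjI impI allI)
  have fin: "finite (edges N1)" using assms(1) by (simp add: multicast_network_def)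
  let ?m = "CARD('a) ^ L + 1"
  let ?N = "construct_network N1 (comb_network ?m) (source_dim N1)"
  obtain A B :: "nat \<Rightarrow> 'a mat" where AB: "\<And>i. A i \<in> carrier_mat L L" "\<And>i. B i \<in> carrier_mat L L"
    "\<And>i j u v. i < j \<Longrightarrow> j < ?m \<Longrightarrow> u \<in> carrier_vec L \<Longrightarrow> v \<in> carrier_vec L \<Longrightarrow>
      A i *\<^sub>v u + B i *\<^sub>v v = 0\<^sub>v L \<Longrightarrow> A j *\<^sub>v u + B j *\<^sub>v v = 0\<^sub>v L \<Longrightarrow> u = 0\<^sub>v L \<and> v = 0\<^sub>v L"
    by (rule spread_matrices[OF assms(4)]) blast
  show "vec_lin_solvable TYPE('a) ?N L"
    by (rule construct_network_solvable[OF assms(1,2,5) AB])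
  show "\<not> vec_lin_solvable TYPE('d) ?N L'" if "L' \<ge> 1" "CARD('d) ^ L' < CARD('a) ^ L" for L'
    \<comment> \<open>Having q^L + 1 middle nodes forces an alphabet of size at least q^L.\<close>
    using comb_network_solvable_bound[OF fin assms(2) that(1)] that(2) by fastforce
  show "\<not> vec_lin_solvable TYPE('b) ?N 1" if le: "CARD('b) \<le> CARD('a) ^ L"
  proof
    assume sol: "vec_lin_solvable TYPE('b) ?N 1"
    then have "?m \<le> CARD('b) ^ 1 + 1"
      by (intro comb_network_solvable_bound[OF fin assms(2)]) simp_all
    \<comment> \<open>The bound is tight here: a field of size at most q^L must have exactly q^L
      elements, and an embedding into \<open>'c\<close> is then a bijection.\<close>
    with le have card: "CARD('b) ^ 1 = CARD('c)" using assms(4) by simp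
    obtain \<phi> :: "'b \<Rightarrow> 'c" where \<phi>: "field_hom \<phi>"
      by (rule finite_field_embedding[OF card])
    then interpret \<phi>: field_hom \<phi> .
    have "inj \<phi>" by (rule \<phi>.inj_f)
    then have "card (range \<phi>) = CARD('c)" using card by (simp add: card_image)
    then have "range \<phi> = UNIV" by (intro card_subset_eq) simp_all
    then have "bij \<phi>" using \<open>inj \<phi>\<close> by (simp add: bij_betw_def)
    moreover have "vec_lin_solvable TYPE('b) N1 1"
      by (rule subnetwork_solvable[OF assms(1) _ finite_comb_network sol]) (use assms(2) in linarith)
    ultimately have "vec_lin_solvable TYPE('c) N1 1"
      by (intro vec_lin_solvable_field_iso[OF \<phi> _ fin])
    then show False using assms(6) by contradiction
  qed
qed

end
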